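(* There is an absolute constant $C>0$ such that for every instance $\mathbb I$ of matroid-WS with alternatives $(X_i,c_i)$, $i\in[n]$, the commitment gap satisfies $\mathrm{CG}(\mathbb I)\le C\max_i\kappa_i$, where $$\kappa_i=\frac{\mu_i}{M_i}+\log\frac{\mu_i}{g_i},$$ $\mu_i=\mathbb E[X_i]$, $M_i$ is the median of $X_i$, and $g_i$ is the Gittins index of alternative $i$, i.e. the solution of $c_i=\mathbb E[(g_i-X_i)^+]$.
   Context: The Weighing Scale (WS) problem, minimization. There are $n$ alternatives $(X_i,c_i)$: $X_i\ge0$ is an independent random value with known distribution and $c_i\ge0$ a weighing cost. The only way to learn about $X_i$ is to weigh it against a threshold $t$ of the decision maker's choosing, at cost $c_i$, learning whether $X_i\le t$. Alternative $i$ is a costly information MDP: in a state representing the current conditional distribution of $X_i$, the actions are (a) weigh against a threshold $t$ (cost $c_i$), moving to the state for $X_i\mid X_i\le t$ or $X_i\mid X_i>t$ according to the outcome, and (b) stop weighing (cost $0$), moving to a terminal state whose value is the current conditional expectation of $X_i$. Matroid-WS is matroid-min-CICS over these MDPs: given a matroid on $[n]$ and $\mathcal F$ the family of subsets containing a basis, a policy adaptively weighs alternatives, selects alternatives in terminal states (paying their terminal value), and stops when the selected set lies in $\mathcal F$; $\mathrm{OPT}(\mathbb I)$ is the minimum expected total cost (weighing costs plus values). A commitment for an alternative fixes in advance a (possibly randomized) weighing protocol depending only on that alternative's own outcomes; $\mathrm{CG}(\mathbb I)$ is the minimum over tuples of commitments of the optimal expected cost of the restricted instance divided by $\mathrm{OPT}(\mathbb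 I)$.
   Formalization: In κ_i, g_i is replaced by min(g_i, μ_i), the index when stopping unweighed is allowed; with g_i > μ_i the literal bound fails (n = 1, X = 1, c = 100: g = 101, κ < 0, but CG = 1). For g_i ≤ μ_i nothing changes. *)

theory Defs
  imports "HOL-Probability.Probability"
begin

section \<open>Matroids\<close>

definition matroid :: "'e set \<Rightarrow> 'e set set \<Rightarrow> bool" where
  "matroid E \<I> \<longleftrightarrow>
     finite E \<and> \<I> \<subseteq> Pow E \<and> {} \<in> \<I> \<and>
     (\<forall>A B. A \<in> \<I> \<longrightarrow> B \<subseteq> A \<longrightarrow> B \<in> \<I>) \<and>
     (\<forall>A\<in>\<I>. \<forall>B\<in>\<I>. card A < card B \<longrightarrow> (\<exists>x\<in>B - A. insert x A \<in> \<I>))"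

definition matroid_basis :: "'e set set \<Rightarrow> 'e set \<Rightarrow> bool" where
  "matroid_basis \<I> B \<longleftrightarrow> B \<in> \<I> \<and> (\<forall>A\<in>\<I>. B \<subseteq> A \<longrightarrow> A = B)"

definition basis_supersets :: "'e set \<Rightarrow> 'e set set \<Rightarrow> 'e set set" where
  "basis_supersets E \<I> = {S. S \<subseteq> E \<and> (\<exists>B. matroid_basis \<I> B \<and> B \<subseteq> S)}"


section \<open>Costly information MDPs and minimum-cost selection\<close>

text \<open>
  Every element of the action type is available in every non-terminal state; in a terminal
  state no action is available.
\<close>

record ('s, 'a) mdp =
  start :: 's
  terminal :: "'s \<Rightarrow> bool"
  val :: "'s \<Rightarrow> ennreal"
  act_cost :: "'s \<Rightarrow> 'a \<Rightarrow> ennreal"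
  trans_prob :: "'s \<Rightarrow> 'a \<Rightarrow> 's pmf"

text \<open>
  A joint state records the state of each of the alternatives 0, ..., n - 1 and the set of
  alternatives selected so far.  Alternatives evolve independently: a move changes the state
  of one alternative only, according to its own transition law.
\<close>

type_synonym 's joint = "(nat \<Rightarrow> 's) \<times> nat set"

datatype 'a move = Act nat 'a | Select nat

text \<open>A policy sees the whole history of joint states, most recent first.\<close>

type_synonym ('s, 'a) policy = "'s joint list \<Rightarrow> 'a move"

fun legal :: "nat \<Rightarrow> (nat \<Rightarrow> ('s, 'a) mdp) \<Rightarrow> 's joint \<Rightarrow> 'a move \<Rightarrow> bool" where
  "legal n \<M> (\<sigma>, S) (Act i a) \<longleftrightarrow> i < n \<and> \<not> terminal (\<M> i) (\<sigma> i)"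
| "legal n \<M> (\<sigma>, S) (Select i) \<longleftrightarrow> i < n \<and> terminal (\<M> i) (\<sigma> i) \<and> i \<notin> S"

fun move_cost :: "(nat \<Rightarrow> ('s, 'a) mdp) \<Rightarrow> 's joint \<Rightarrow> 'a move \<Rightarrow> ennreal" where
  "move_cost \<M> (\<sigma>, S) (Act i a) = act_cost (\<M> i) (\<sigma> i) a"
| "move_cost \<M> (\<sigma>, S) (Select i) = val (\<M> i) (\<sigma> i)"

fun move_result :: "(nat \<Rightarrow> ('s, 'a) mdp) \<Rightarrow> 's joint \<Rightarrow> 'a move \<Rightarrow> 's joint pmf" where
  "move_result \<M> (\<sigma>, S) (Act i a) =
     map_pmf (\<lambda>s'. (\<sigma>(i := s'), S)) (trans_prob (\<M> i) (\<sigma> i) a)"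
| "move_result \<M> (\<sigma>, S) (Select i) = return_pmf (\<sigma>, insert i S)"

text \<open>
  The run ends as soon as the selected set is feasible; from then on the history no longer
  changes.
\<close>

definition finished :: "nat set set \<Rightarrow> 's joint list \<Rightarrow> bool" where
  "finished \<F> h \<longleftrightarrow> snd (hd h) \<in> \<F>"

primrec run ::
    "nat set set \<Rightarrow> (nat \<Rightarrow> ('s, 'a) mdp) \<Rightarrow> ('s, 'a) policy \<Rightarrow> nat \<Rightarrow> 's joint list pmf" where
  "run \<F> \<M> \<pi> 0 = return_pmf [(\<lambda>i. start (\<M> i), {})]"
| "run \<F> \<M> \<pi> (Suc k) =
     bind_pmf (run \<F> \<M> \<pi> k)
       (\<lambda>h. if finished \<F> h then return_pmf h
            else map_pmf (\<lambda>s. s # h) (move_result \<M> (hd h) (\<pi> h)))"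

text \<open>Charging an infinite cost for illegal moves excludes policies that may ever make one.\<close>

definition step_cost ::
    "nat \<Rightarrow> nat set set \<Rightarrow> (nat \<Rightarrow> ('s, 'a) mdp) \<Rightarrow> ('s, 'a) policy \<Rightarrow> 's joint list \<Rightarrow> ennreal" where
  "step_cost n \<F> \<M> \<pi> h =
     (if finished \<F> h then 0
      else if legal n \<M> (hd h) (\<pi> h) then move_cost \<M> (hd h) (\<pi> h)
      else \<infinity>)"

definition expected_cost ::
    "nat \<Rightarrow> nat set set \<Rightarrow> (nat \<Rightarrow> ('s, 'a) mdp) \<Rightarrow> ('s, 'a) policy \<Rightarrow> ennreal" where
  "expected_cost n \<F> \<M> \<pi> =
     (\<Sum>k. \<integral>\<^sup>+ h. step_cost n \<F> \<M> \<pi> h \<partial>measure_pmf (run \<F> \<M> \<pi> k))"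

definition finishes_almost_surely ::
    "nat set set \<Rightarrow> (nat \<Rightarrow> ('s, 'a) mdp) \<Rightarrow> ('s, 'a) policy \<Rightarrow> bool" where
  "finishes_almost_surely \<F> \<M> \<pi> \<longleftrightarrow>
     (\<lambda>k. measure_pmf.prob (run \<F> \<M> \<pi> k) {h. finished \<F> h}) \<longlonglongrightarrow> 1"

definition opt_cost :: "nat \<Rightarrow> nat set set \<Rightarrow> (nat \<Rightarrow> ('s, 'a) mdp) \<Rightarrow> ennreal" where
  "opt_cost n \<F> \<M> =
     (INF \<pi>\<in>{\<pi>. finishes_almost_surely \<F> \<M> \<pi>}. expected_cost n \<F> \<M> \<pi>)"


section \<open>Commitments\<close>

text \<open>
  A commitment prescribes a random next action given the history (most recent first) of the
  alternative's own states.  The restricted process is the resulting Markov chain on these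
  histories, whose only action is to advance the protocol by one step; its cost is the mean
  cost of the action drawn.
\<close>

type_synonym ('s, 'a) commitment = "'s list \<Rightarrow> 'a pmf"

definition restrict_mdp :: "('s, 'a) mdp \<Rightarrow> ('s, 'a) commitment \<Rightarrow> ('s list, unit) mdp" where
  "restrict_mdp m \<phi> =
     \<lparr> start = [start m],
       terminal = (\<lambda>h. terminal m (hd h)),
       val = (\<lambda>h. val m (hd h)),
       act_cost = (\<lambda>h _. \<integral>\<^sup>+ a. act_cost m (hd h) a \<partial>measure_pmf (\<phi> h)),
       trans_prob = (\<lambda>h _. bind_pmf (\<phi> h) (\<lambda>a. map_pmf (\<lambda>s. s # h) (trans_prob m (hd h) a))) \<rparr>"

text \<open>
  In the type of extended nonnegative reals the quotient is 0 if both costs are 0 (as for a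
  matroid of rank 0) and infinite if only the denominator is 0.
\<close>

definition commitment_gap :: "nat \<Rightarrow> nat set set \<Rightarrow> (nat \<Rightarrow> ('s, 'a) mdp) \<Rightarrow> ennreal" where
  "commitment_gap n \<F> \<M> =
     (INF \<phi>. opt_cost n \<F> (\<lambda>i. restrict_mdp (\<M> i) (\<phi> i))) / opt_cost n \<F> \<M>"


section \<open>The weighing scale problem\<close>

text \<open>
  States carry the current conditional law of the value; \<open>Open\<close> states still allow
  weighing, \<open>Closed\<close> states are terminal.  Conditioning on an event is
  \<^const>\<open>uniform_measure\<close>; an outcome of probability 0 is never reached.
\<close>

datatype ws_state = Open "real measure" | Closed "real measure"

datatype ws_action = Weigh real | Stop

fun ws_law :: "ws_state \<Rightarrow> real measure" where
  "ws_law (Open D) = D"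
| "ws_law (Closed D) = D"

fun ws_trans :: "ws_state \<Rightarrow> ws_action \<Rightarrow> ws_state pmf" where
  "ws_trans s (Weigh t) =
     map_pmf (\<lambda>b. Open (uniform_measure (ws_law s) (if b then {..t} else {t<..})))
       (bernoulli_pmf (measure (ws_law s) {..t}))"
| "ws_trans s Stop = return_pmf (Closed (ws_law s))"

fun ws_cost :: "real \<Rightarrow> ws_action \<Rightarrow> ennreal" where
  "ws_cost c (Weigh t) = ennreal c"
| "ws_cost c Stop = 0"

definition ws_mdp :: "real measure \<Rightarrow> real \<Rightarrow> (ws_state, ws_action) mdp" where
  "ws_mdp D c =
     \<lparr> start = Open D,
       terminal = (\<lambda>s. \<exists>D'. s = Closed D'),
       val = (\<lambda>s. \<integral>\<^sup>+ x. ennreal x \<partial>ws_law s),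
       act_cost = (\<lambda>s. ws_cost c),
       trans_prob = ws_trans \<rparr>"

definition matroid_ws_instance ::
    "nat \<Rightarrow> nat set set \<Rightarrow> (nat \<Rightarrow> real measure) \<Rightarrow> (nat \<Rightarrow> real) \<Rightarrow> bool" where
  "matroid_ws_instance n \<I> D c \<longleftrightarrow>
     matroid {..<n} \<I> \<and>
     (\<forall>i<n. prob_space (D i) \<and> sets (D i) = sets borel \<and> (AE x in D i. 0 \<le> x) \<and>
            integrable (D i) (\<lambda>x. x) \<and> 0 \<le> c i)"

definition ws_commitment_gap ::
    "nat \<Rightarrow> nat set set \<Rightarrow> (nat \<Rightarrow> real measure) \<Rightarrow> (nat \<Rightarrow> real) \<Rightarrow> ennreal" where
  "ws_commitment_gap n \<I> D c =
     commitment_gap n (basis_supersets {..<n} \<I>) (\<lambda>i. ws_mdp (D i) (c i))"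

definition mean :: "real measure \<Rightarrow> real" where
  "mean D = (\<integral>x. x \<partial>D)"

definition is_median :: "real measure \<Rightarrow> real \<Rightarrow> bool" where
  "is_median D M \<longleftrightarrow> measure D {..M} \<ge> 1/2 \<and> measure D {M..} \<ge> 1/2"

text \<open>
  For \<open>c > 0\<close> there is exactly one solution; for \<open>c = 0\<close> the solutions are the numbers up to
  the essential infimum of the value.
\<close>

definition solves_gittins_equation :: "real measure \<Rightarrow> real \<Rightarrow> real \<Rightarrow> bool" where
  "solves_gittins_equation D c g \<longleftrightarrow> c = (\<integral>x. max (g - x) 0 \<partial>D)"

text \<open>
  If the solution \<open>g\<close> of the equation exceeds the mean, weighing is never worthwhile and the
  Gittins index of the alternative is its mean; hence the minimum.  With \<open>g\<close> itself, kappa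
  would be negative for a constant value 1 and weighing cost 100, where \<open>g = 101\<close>, whereas
  the commitment gap is 1.

  Kappa is infinite if a denominator vanishes.  A solution \<open>g \<le> 0\<close> occurs only for \<open>c = 0\<close>.
\<close>

definition ws_kappa :: "real measure \<Rightarrow> real \<Rightarrow> real \<Rightarrow> ennreal" where
  "ws_kappa D M g =
     (if M > 0 \<and> g > 0 then ennreal (mean D / M + ln (mean D / min g (mean D))) else \<infinity>)"

end

theory Submission
  imports Defs
begin

text \<open>
  Write \<open>g\<close> for the Gittins index capped at the mean, and \<open>\<Phi>(w)\<close> for the least total weight
  of a feasible set.  In each coordinate \<open>\<Phi>\<close> has the form \<open>min (A + w\<^sub>i) B\<close>, so the expectation of
  \<open>\<Phi>\<close> under independent random weights attached to the current states can serve as a potential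
  whose change under a move is estimated for one alternative at a time.

  With weights \<open>max X\<^sub>i g\<^sub>i\<close> at the start, no policy can decrease the potential by more than twice the
  cost that it pays; hence \<open>E \<Phi>(max X g) \<le> 2 OPT\<close>.

  Conversely, let \<open>\<alpha> = 10 max \<kappa>\<close> and commit to weighing against
  \<open>M\<^sub>i/2, M\<^sub>i/4, \<dots>\<close> until \<open>X\<^sub>i\<close> is known up to a factor 2, or is known to
  exceed \<open>M\<^sub>i/2\<close>, or to be at most \<open>2 g\<^sub>i\<close>.  The terminal value is then at most
  \<open>\<alpha> max X\<^sub>i g\<^sub>i\<close> pointwise.  The greedy policy that treats an unweighed alternative
  as if it had the price \<open>\<alpha> g\<^sub>i\<close> costs at most \<open>E \<Phi>(\<alpha> max X g) = \<alpha> E \<Phi>(max X g)\<close>: by basis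
  exchange the alternative that it advances has \<open>B \<ge> A + \<alpha> g\<^sub>i\<close>, so lowering its weight below
  \<open>\<alpha> g\<^sub>i\<close> lowers \<open>\<Phi>\<close> by the same amount, which pays for the weighings.
\<close>

section \<open>Cheapest completions\<close>

text \<open>On a linear order a monotone map commutes with binary minima, hence with finite infima.
  \<open>h top = top\<close> settles the empty infimum, which arises when no feasible set is
  left.\<close>

lemma INF_mono_commute_finite:
  fixes h :: "'a :: complete_linorder \<Rightarrow> 'b :: complete_linorder"
  assumes "finite A" "mono h" "h top = top"
  shows "(INF x\<in>A. h (f x)) = h (INF x\<in>A. f x)"
  using assms(1) by induction (simp_all add: assms inf_min min_of_mono)

definition completion_cost :: "nat set set \<Rightarrow> nat set \<Rightarrow> (nat \<Rightarrow> ennreal) \<Rightarrow> ennreal" where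
  "completion_cost \<F> S w = (INF T\<in>{T \<in> \<F>. S \<subseteq> T}. sum w (T - S))"

text \<open>The bound \<open>B\<close> of the form \<open>min (A + w_i) B\<close>: it does not see
  the weight of \<open>i\<close>, and it is \<open>top\<close> if every feasible superset of
  \<open>S\<close> contains \<open>i\<close>.\<close>

definition avoiding_cost :: "nat set set \<Rightarrow> nat set \<Rightarrow> nat \<Rightarrow> (nat \<Rightarrow> ennreal) \<Rightarrow> ennreal" where
  "avoiding_cost \<F> S i w = (INF T\<in>{T \<in> \<F>. S \<subseteq> T \<and> i \<notin> T}. sum w (T - S))"

lemma completion_cost_feasible: "S \<in> \<F> \<Longrightarrow> completion_cost \<F> S w = 0"
  unfolding completion_cost_def
  by (rule antisym, rule INF_lower2[of S]) auto

lemma completion_cost_cmult: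
  assumes "finite \<F>" "0 < a"
  shows "completion_cost \<F> S (\<lambda>i. ennreal a * w i) = ennreal a * completion_cost \<F> S w"
  unfolding completion_cost_def sum_distrib_left[symmetric] using assms
  by (intro INF_mono_commute_finite) (auto intro!: monoI mult_left_mono simp: ennreal_mult_top)

text \<open>Contraction and deletion: a completion of \<open>S\<close> either uses \<open>i\<close>,
  paying \<open>w i\<close> and completing \<open>insert i S\<close>, or avoids
  \<open>i\<close>.\<close>

lemma completion_cost_select:
  assumes "finite \<F>" "\<And>T. T \<in> \<F> \<Longrightarrow> finite T" "i \<notin> S"
  shows "completion_cost \<F> S w =
    min (completion_cost \<F> (insert i S) w + w i) (avoiding_cost \<F> S i w)"
proof -
  have split: "{T \<in> \<F>. S \<subseteq> T} = {T \<in> \<F>. insert i S \<subseteq> T} \<union> {T \<in> \<F>. S \<subseteq> T \<and> i \<notin> T}"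
    by auto
  have "sum w (T - S) = sum w (T - insert i S) + w i" if "T \<in> \<F>" "insert i S \<subseteq> T" for T
    using that assms sum.remove[of "T - S" i w] 
    by (simp add: Diff_insert[symmetric] add.commute)
  then have "(INF T\<in>{T \<in> \<F>. insert i S \<subseteq> T}. sum w (T - S))
      = (INF T\<in>{T \<in> \<F>. insert i S \<subseteq> T}. sum w (T - insert i S) + w i)"
    by (intro INF_cong) auto
  also have "\<dots> = completion_cost \<F> (insert i S) w + w i"
    unfolding completion_cost_def using assms(1)
    by (intro INF_mono_commute_finite[of _ "\<lambda>x. x + w i"]) (auto intro!: monoI add_right_mono)
  finally show ?thesis
    unfolding completion_cost_def[of \<F> S] avoiding_cost_def split INF_union inf_min by simp
qed

lemma completion_cost_upd_insert:
  "completion_cost \<F> (insert i S) (w(i := y)) = completion_cost \<F> (insert i S) w"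
  unfolding completion_cost_def by (intro INF_cong sum.cong) auto

lemma avoiding_cost_upd: "avoiding_cost \<F> S i (w(i := y)) = avoiding_cost \<F> S i w"
  unfolding avoiding_cost_def by (intro INF_cong sum.cong) auto

lemma completion_cost_upd:
  assumes "finite \<F>" "\<And>T. T \<in> \<F> \<Longrightarrow> finite T" "i \<notin> S"
  shows "completion_cost \<F> S (w(i := y)) =
    min (completion_cost \<F> (insert i S) w + y) (avoiding_cost \<F> S i w)"
  using completion_cost_select[OF assms, of "w(i := y)"]
  by (simp add: completion_cost_upd_insert avoiding_cost_upd)

lemma completion_cost_upd_ex:
  assumes "finite \<F>" "\<And>T. T \<in> \<F> \<Longrightarrow> finite T"
  shows "\<exists>A B. \<forall>y. completion_cost \<F> S (w(i := y)) = min (A + y) B"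
proof (cases "i \<in> S")
  case True
  then have "completion_cost \<F> S (w(i := y)) = completion_cost \<F> S w" for y
    using completion_cost_upd_insert[of \<F> i S w y] by (simp add: insert_absorb)
  \<comment> \<open>\<open>A = top\<close> makes the minimum constant in \<open>y\<close>: the
    weight of a selected alternative no longer matters.\<close>
  then show ?thesis
    by (intro exI[of _ top] exI[of _ "completion_cost \<F> S w"]) simp
next
  case False
  then show ?thesis using completion_cost_upd[OF assms False] by blast
qed

section \<open>Matroid exchange\<close>

lemma matroid_hereditary: "matroid E \<I> \<Longrightarrow> A \<in> \<I> \<Longrightarrow> B \<subseteq> A \<Longrightarrow> B \<in> \<I>"
  unfolding matroid_def by meson

lemma matroid_carrier: "matroid E \<I> \<Longrightarrow> A \<in> \<I> \<Longrightarrow> A \<subseteq> E"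
  unfolding matroid_def by auto

lemma matroid_finite_ground: "matroid E \<I> \<Longrightarrow> finite E"
  unfolding matroid_def by simp

lemma matroid_finite: "matroid E \<I> \<Longrightarrow> A \<in> \<I> \<Longrightarrow> finite A"
  using matroid_carrier matroid_finite_ground finite_subset by metis

lemma matroid_augment:
  "matroid E \<I> \<Longrightarrow> A \<in> \<I> \<Longrightarrow> B \<in> \<I> \<Longrightarrow> card A < card B \<Longrightarrow> \<exists>x\<in>B - A. insert x A \<in> \<I>"
  unfolding matroid_def by meson

text \<open>Augmentation is iterated until \<open>J\<close> is as large as \<open>B\<close>; the
  induction is on the deficit in cardinality.\<close>

lemma matroid_extend:
  assumes "matroid E \<I>" "A \<in> \<I>" "B \<in> \<I>"
  shows "\<exists>J\<in>\<I>. A \<subseteq> J \<and> J \<subseteq> A \<union> B \<and> card B \<le> card J"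
  using assms(2)
proof (induction "card B - card A" arbitrary: A)
  case 0
  then show ?case by (intro bexI[of _ A]) auto
next
  case (Suc k)
  then have "card A < card B" by simp
  then obtain x where x: "x \<in> B - A" "insert x A \<in> \<I>"
    using assms(1,3) Suc.prems unfolding matroid_def by blast
  moreover have "finite A" by (rule matroid_finite[OF assms(1) Suc.prems])
  ultimately have "k = card B - card (insert x A)" using Suc.hyps(2) by simp
  from Suc.hyps(1)[OF this x(2)] x(1) show ?case by blast
qed

lemma matroid_basis_card_le:
  assumes "matroid E \<I>" "A \<in> \<I>" "matroid_basis \<I> B"
  shows "card A \<le> card B"
proof (rule ccontr)
  assume "\<not> ?thesis"
  then obtain x where "x \<in> A - B" "insert x B \<in> \<I>"
    using assms unfolding matroid_def matroid_basis_def by (metis not_le)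
  then show False using assms(3) unfolding matroid_basis_def by blast
qed

lemma matroid_basisI_card:
  assumes "matroid E \<I>" "matroid_basis \<I> B" "J \<in> \<I>" "card B \<le> card J"
  shows "matroid_basis \<I> J"
  unfolding matroid_basis_def
proof (intro conjI ballI impI assms)
  fix A assume A: "A \<in> \<I>" "J \<subseteq> A"
  then have "finite A" using matroid_finite[OF assms(1)] by simp
  moreover have "card A \<le> card J" using matroid_basis_card_le[OF assms(1) A(1) assms(2)] assms(4) by simp
  ultimately show "A = J" using A(2) by (metis card_seteq)
qed

text \<open>Extend \<open>insert i S\<close> to a basis \<open>J\<close> inside
  \<open>insert i S \<union> B\<close>, where \<open>B \<subseteq> T\<close> is a basis. Without
  \<open>i\<close>, \<open>J\<close> is smaller than \<open>B\<close>, so some \<open>j\<close> in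
  \<open>B\<close> augments it, and \<open>insert j S\<close> is independent as well. The parts
  \<open>J - insert i S\<close> and \<open>{j}\<close> of \<open>T - S\<close> are disjoint, so the
  weight of \<open>T - S\<close> covers both.\<close>

lemma matroid_exchange:
  assumes "matroid E \<I>" "insert i S \<in> \<I>" "i \<notin> S" "T \<in> basis_supersets E \<I>" "S \<subseteq> T" "i \<notin> T"
  obtains J j where "J \<in> basis_supersets E \<I>" "insert i S \<subseteq> J" "j \<in> T - S" "j \<noteq> i"
    "insert j S \<in> \<I>" "j \<notin> J" "J - insert i S \<subseteq> T - S"
proof -
  obtain B where B: "matroid_basis \<I> B" "B \<subseteq> T" "T \<subseteq> E"
    using assms(4) unfolding basis_supersets_def by blast
  then have "B \<in> \<I>" unfolding matroid_basis_def by blast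
  from matroid_extend[OF assms(1,2) this] obtain J where
    J: "J \<in> \<I>" "insert i S \<subseteq> J" "J \<subseteq> insert i S \<union> B" "card B \<le> card J" by blast
  have finJ: "finite J" by (rule matroid_finite[OF assms(1) J(1)])
  have "matroid_basis \<I> J" by (rule matroid_basisI_card[OF assms(1) B(1) J(1,4)])
  moreover have "J \<subseteq> E" by (rule matroid_carrier[OF assms(1) J(1)])
  ultimately have JF: "J \<in> basis_supersets E \<I>" unfolding basis_supersets_def by blast
  have "card J \<le> card B" by (rule matroid_basis_card_le[OF assms(1) J(1) B(1)])
  moreover have "card (J - {i}) < card J" using J(2) finJ by (intro card_Diff1_less) auto
  ultimately have "card (J - {i}) < card B" by simp
  then obtain j where j: "j \<in> B - (J - {i})" "insert j (J - {i}) \<in> \<I>"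
    using matroid_augment[OF assms(1) matroid_hereditary[OF assms(1) J(1), of "J - {i}"] \<open>B \<in> \<I>\<close>] by auto
  have "j \<noteq> i" using j(1) B(2) assms(6) by blast
  moreover have "insert j S \<in> \<I>" using J(2) assms(3) by (intro matroid_hereditary[OF assms(1) j(2)]) auto
  moreover have "j \<in> T - S" "j \<notin> J" "J - insert i S \<subseteq> T - S"
    using j(1) J(2,3) B(2) \<open>j \<noteq> i\<close> by auto
  ultimately show ?thesis using that[OF JF J(2)] by simp
qed

text \<open>This is the optimality of the greedy rule: a completion avoiding \<open>i\<close>
  contains a completion of \<open>insert i S\<close> and, disjoint from it, an exchange element that
  costs at least \<theta>. The bound does not involve \<open>w i\<close>, so it survives when a
  weighing lowers that weight.\<close>

lemma avoiding_cost_ge: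
  assumes "matroid E \<I>" "insert i S \<in> \<I>" "i \<notin> S"
    and \<theta>: "\<And>j. j \<notin> S \<Longrightarrow> j \<noteq> i \<Longrightarrow> insert j S \<in> \<I> \<Longrightarrow> \<theta> \<le> w j"
  shows "completion_cost (basis_supersets E \<I>) (insert i S) w + \<theta>
    \<le> avoiding_cost (basis_supersets E \<I>) S i w"
  unfolding avoiding_cost_def
proof (rule INF_greatest)
  fix T assume "T \<in> {T \<in> basis_supersets E \<I>. S \<subseteq> T \<and> i \<notin> T}"
  then have T: "T \<in> basis_supersets E \<I>" "S \<subseteq> T" "i \<notin> T" by auto
  have "T \<subseteq> E" using T(1) unfolding basis_supersets_def by simp
  then have "finite T" by (rule finite_subset[OF _ matroid_finite_ground[OF assms(1)]])
  from matroid_exchange[OF assms(1-3) T] obtain J j where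
    J: "J \<in> basis_supersets E \<I>" "insert i S \<subseteq> J" "j \<in> T - S" "j \<noteq> i"
    "insert j S \<in> \<I>" "j \<notin> J" "J - insert i S \<subseteq> T - S" .
  have "completion_cost (basis_supersets E \<I>) (insert i S) w + \<theta> \<le> sum w (J - insert i S) + w j"
    unfolding completion_cost_def using J \<theta> by (intro add_mono INF_lower) auto
  also have "\<dots> = sum w (insert j (J - insert i S))"
    using J finite_subset[OF J(7)] \<open>finite T\<close> by (subst sum.insert) (simp_all add: add.commute)
  also have "\<dots> \<le> sum w (T - S)"
    using J \<open>finite T\<close> by (intro sum_mono2) auto
  finally show "completion_cost (basis_supersets E \<I>) (insert i S) w + \<theta> \<le> sum w (T - S)" .
qed

lemma matroid_eligible_exists:
  assumes "matroid E \<I>" "S \<in> \<I>" "S \<notin> basis_supersets E \<I>"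
  shows "\<exists>i\<in>E - S. insert i S \<in> \<I>"
proof -
  have "S \<subseteq> E" by (rule matroid_carrier[OF assms(1,2)])
  then have "\<not> matroid_basis \<I> S" using assms(3) unfolding basis_supersets_def by blast
  then obtain A where A: "A \<in> \<I>" "S \<subseteq> A" "A \<noteq> S" using assms(2) unfolding matroid_basis_def by blast
  then obtain i where "i \<in> A - S" by blast
  moreover have "insert i S \<in> \<I>"
    using A(2) \<open>i \<in> A - S\<close> by (intro matroid_hereditary[OF assms(1) A(1)]) auto
  moreover have "A \<subseteq> E" by (rule matroid_carrier[OF assms(1) A(1)])
  ultimately show ?thesis by blast
qed

section \<open>Potentials along a run\<close>

lemma set_pmf_run_invariant:
  assumes "Q (\<lambda>i. start (\<M> i), {})"
    and "\<And>h s. Q (hd h) \<Longrightarrow> \<not> finished \<F> h \<Longrightarrow> s \<in> set_pmf (move_result \<M> (hd h) (\<pi> h)) \<Longrightarrow> Q s"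
    and "h \<in> set_pmf (run \<F> \<M> \<pi> k)"
  shows "Q (hd h)"
  using assms(3)
proof (induction k arbitrary: h)
  case 0
  then show ?case using assms(1) by simp
next
  case (Suc k)
  then obtain h0 where h0: "h0 \<in> set_pmf (run \<F> \<M> \<pi> k)"
    "h \<in> set_pmf (if finished \<F> h0 then return_pmf h0
       else map_pmf (\<lambda>s. s # h0) (move_result \<M> (hd h0) (\<pi> h0)))" by auto
  show ?case
    using h0(2) assms(2)[OF Suc.IH[OF h0(1)]] Suc.IH[OF h0(1)] by (cases "finished \<F> h0") auto
qed

text \<open>Submartingale argument: by telescoping, the initial potential is at most \<beta> times
  the cost of the first \<open>K\<close> steps plus the expected potential after them. This
  remainder is at most \<open>b\<close> times the probability of being unfinished, which tends to
  0.\<close>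

lemma potential_le_expected_cost:
  fixes V :: "'s joint \<Rightarrow> ennreal"
  assumes init: "Q (\<lambda>i. start (\<M> i), {})"
    and inv: "\<And>st m s. Q st \<Longrightarrow> s \<in> set_pmf (move_result \<M> st m) \<Longrightarrow> Q s"
    and step: "\<And>st m. Q st \<Longrightarrow> legal n \<M> st m \<Longrightarrow>
      V st \<le> \<beta> * move_cost \<M> st m + (\<integral>\<^sup>+ s. V s \<partial>measure_pmf (move_result \<M> st m))"
    and zero: "\<And>\<sigma> S. S \<in> \<F> \<Longrightarrow> V (\<sigma>, S) = 0"
    and bounded: "\<And>st. Q st \<Longrightarrow> V st \<le> ennreal b"
    and \<beta>: "\<beta> > 0"
    and fas: "finishes_almost_surely \<F> \<M> \<pi>"
  shows "V (\<lambda>i. start (\<M> i), {}) \<le> \<beta> * expected_cost n \<F> \<M> \<pi>"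
proof -
  let ?R = "\<lambda>k. measure_pmf (run \<F> \<M> \<pi> k)"
  let ?step = "step_cost n \<F> \<M> \<pi>"
  let ?init = "(\<lambda>i. start (\<M> i), {})"
  have Q: "Q (hd h)" if "h \<in> set_pmf (run \<F> \<M> \<pi> k)" for h k
    using set_pmf_run_invariant[of Q \<M> \<F> \<pi>] init inv that by blast
  \<comment> \<open>An illegal move costs infinity, and \<beta> > 0 keeps the right side infinite; a
    finished history does not change.\<close>
  have one: "V (hd h) \<le> \<beta> * ?step h + (\<integral>\<^sup>+ h'. V (hd h') \<partial>measure_pmf
      (if finished \<F> h then return_pmf h else map_pmf (\<lambda>s. s # h) (move_result \<M> (hd h) (\<pi> h))))"
    if "Q (hd h)" for h
    using step[OF that, of "\<pi> h"] \<beta> by (auto simp: step_cost_def ennreal_mult_top)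
  have telescope: "V ?init \<le> \<beta> * (\<Sum>k<K. \<integral>\<^sup>+ h. ?step h \<partial>?R k) + (\<integral>\<^sup>+ h. V (hd h) \<partial>?R K)" for K
  proof (induction K)
    case 0
    then show ?case by simp
  next
    case (Suc K)
    have "(\<integral>\<^sup>+ h. V (hd h) \<partial>?R K) \<le> \<beta> * (\<integral>\<^sup>+ h. ?step h \<partial>?R K) + (\<integral>\<^sup>+ h. V (hd h) \<partial>?R (Suc K))"
      unfolding run.simps nn_integral_bind_pmf
      by (subst nn_integral_cmult[symmetric], simp, subst nn_integral_add[symmetric], simp, simp,
          intro nn_integral_mono_AE)
         (use one Q in \<open>auto simp: AE_measure_pmf_iff\<close>)
    with Suc.IH show ?case
      by (simp only: sum.lessThan_Suc distrib_left add.assoc) (meson add_left_mono order_trans)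
  qed
  have tail: "(\<integral>\<^sup>+ h. V (hd h) \<partial>?R K)
      \<le> ennreal b * ennreal (1 - measure_pmf.prob (run \<F> \<M> \<pi> K) {h. finished \<F> h})" for K
  proof -
    have "V (hd h) \<le> ennreal b * indicator (- {h. finished \<F> h}) h"
      if "h \<in> set_pmf (run \<F> \<M> \<pi> K)" for h
      using zero[of "snd (hd h)" "fst (hd h)"] bounded[OF Q[OF that]]
      by (auto simp: finished_def indicator_def)
    then have "(\<integral>\<^sup>+ h. V (hd h) \<partial>?R K) \<le> (\<integral>\<^sup>+ h. ennreal b * indicator (- {h. finished \<F> h}) h \<partial>?R K)"
      by (intro nn_integral_mono_AE) (auto simp: AE_measure_pmf_iff)
    also have "\<dots> = ennreal b * emeasure (?R K) (- {h. finished \<F> h})"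
      by (rule nn_integral_cmult_indicator) simp
    finally show ?thesis
      by (simp add: measure_pmf.emeasure_eq_measure Compl_eq_Diff_UNIV measure_pmf.prob_compl[of _ , simplified])
  qed
  have le: "V ?init \<le> \<beta> * expected_cost n \<F> \<M> \<pi>
      + ennreal b * ennreal (1 - measure_pmf.prob (run \<F> \<M> \<pi> K) {h. finished \<F> h})" for K
  proof -
    have "(\<Sum>k<K. \<integral>\<^sup>+ h. ?step h \<partial>?R k) \<le> expected_cost n \<F> \<M> \<pi>"
      unfolding expected_cost_def by (rule sum_le_suminf) auto
    then show ?thesis
      using telescope[of K] tail[of K] by (meson add_mono mult_left_mono order_trans zero_le)
  qed
  have "(\<lambda>K. ennreal (1 - measure_pmf.prob (run \<F> \<M> \<pi> K) {h. finished \<F> h})) \<longlonglongrightarrow> ennreal (1 - 1)"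
    using fas unfolding finishes_almost_surely_def by (intro tendsto_intros)
  then have "(\<lambda>K. ennreal b * ennreal (1 - measure_pmf.prob (run \<F> \<M> \<pi> K) {h. finished \<F> h}))
      \<longlonglongrightarrow> ennreal b * ennreal (1 - 1)"
    by (intro ennreal_tendsto_cmult) auto
  then have "(\<lambda>K. \<beta> * expected_cost n \<F> \<M> \<pi>
      + ennreal b * ennreal (1 - measure_pmf.prob (run \<F> \<M> \<pi> K) {h. finished \<F> h}))
      \<longlonglongrightarrow> \<beta> * expected_cost n \<F> \<M> \<pi> + ennreal b * ennreal (1 - 1)"
    by (intro tendsto_add tendsto_const)
  from LIMSEQ_le_const[OF this] le show ?thesis by auto
qed

lemma expected_cost_le_potential:
  fixes V :: "'s joint \<Rightarrow> ennreal"
  assumes init: "Q (\<lambda>i. start (\<M> i), {})"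
    and inv: "\<And>h s. Q (hd h) \<Longrightarrow> \<not> finished \<F> h \<Longrightarrow> s \<in> set_pmf (move_result \<M> (hd h) (\<pi> h)) \<Longrightarrow> Q s"
    and legal: "\<And>h. Q (hd h) \<Longrightarrow> \<not> finished \<F> h \<Longrightarrow> legal n \<M> (hd h) (\<pi> h)"
    and step: "\<And>h. Q (hd h) \<Longrightarrow> \<not> finished \<F> h \<Longrightarrow>
      move_cost \<M> (hd h) (\<pi> h) + (\<integral>\<^sup>+ s. V s \<partial>measure_pmf (move_result \<M> (hd h) (\<pi> h))) \<le> V (hd h)"
  shows "expected_cost n \<F> \<M> \<pi> \<le> V (\<lambda>i. start (\<M> i), {})"
proof -
  let ?R = "\<lambda>k. measure_pmf (run \<F> \<M> \<pi> k)"
  let ?step = "step_cost n \<F> \<M> \<pi>"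
  let ?init = "(\<lambda>i. start (\<M> i), {})"
  have Q: "Q (hd h)" if "h \<in> set_pmf (run \<F> \<M> \<pi> k)" for h k
    using set_pmf_run_invariant[of Q \<M> \<F> \<pi>] init inv that by blast
  have one: "?step h + (\<integral>\<^sup>+ h'. V (hd h') \<partial>measure_pmf
      (if finished \<F> h then return_pmf h else map_pmf (\<lambda>s. s # h) (move_result \<M> (hd h) (\<pi> h))))
      \<le> V (hd h)"
    if "Q (hd h)" for h
    using step[OF that] legal[OF that] by (auto simp: step_cost_def)
  have telescope: "(\<Sum>k<K. \<integral>\<^sup>+ h. ?step h \<partial>?R k) + (\<integral>\<^sup>+ h. V (hd h) \<partial>?R K) \<le> V ?init" for K
  proof (induction K)
    case 0
    then show ?case by simp
  next
    case (Suc K)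
    have "(\<integral>\<^sup>+ h. ?step h \<partial>?R K) + (\<integral>\<^sup>+ h. V (hd h) \<partial>?R (Suc K)) \<le> (\<integral>\<^sup>+ h. V (hd h) \<partial>?R K)"
      unfolding run.simps nn_integral_bind_pmf
      by (subst nn_integral_add[symmetric], simp, simp, intro nn_integral_mono_AE)
         (use one Q in \<open>auto simp: AE_measure_pmf_iff\<close>)
    with Suc.IH show ?case
      by (simp only: sum.lessThan_Suc add.assoc) (meson add_left_mono order_trans)
  qed
  have "(\<Sum>k<K. \<integral>\<^sup>+ h. ?step h \<partial>?R k) \<le> V ?init" for K
    using telescope[of K] by (rule order_trans[rotated]) simp
  then show ?thesis
    unfolding expected_cost_def by (intro suminf_le_const) auto
qed

text \<open>After \<open>k\<close> steps the counter of an unfinished history is at least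
  \<open>k\<close>; hence every history is finished once \<open>k > N\<close>, and the probability
  is eventually constant.\<close>

lemma finishes_almost_surelyI_counter:
  fixes r :: "'s joint \<Rightarrow> nat"
  assumes init: "Q (\<lambda>i. start (\<M> i), {})"
    and inv: "\<And>h s. Q (hd h) \<Longrightarrow> \<not> finished \<F> h \<Longrightarrow> s \<in> set_pmf (move_result \<M> (hd h) (\<pi> h)) \<Longrightarrow>
      Q s \<and> r (hd h) < r s"
    and bound: "\<And>st. Q st \<Longrightarrow> r st \<le> N"
  shows "finishes_almost_surely \<F> \<M> \<pi>"
proof -
  have Q: "Q (hd h)" if "h \<in> set_pmf (run \<F> \<M> \<pi> k)" for h k
    using set_pmf_run_invariant[of Q \<M> \<F> \<pi>] init inv that by blast
  have count: "finished \<F> h \<or> k \<le> r (hd h)" if "h \<in> set_pmf (run \<F> \<M> \<pi> k)" for h k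
    using that
  proof (induction k arbitrary: h)
    case (Suc k)
    from Suc.prems obtain h0 where h0: "h0 \<in> set_pmf (run \<F> \<M> \<pi> k)"
      "h \<in> set_pmf (if finished \<F> h0 then return_pmf h0
         else map_pmf (\<lambda>s. s # h0) (move_result \<M> (hd h0) (\<pi> h0)))" by auto
    show ?case
    proof (cases "finished \<F> h0")
      case False
      then obtain s where "s \<in> set_pmf (move_result \<M> (hd h0) (\<pi> h0))" "h = s # h0"
        using h0(2) by auto
      then show ?thesis using inv[OF Q[OF h0(1)] False, of s] Suc.IH[OF h0(1)] False by simp
    qed (use h0 in auto)
  qed simp
  have "measure_pmf.prob (run \<F> \<M> \<pi> k) {h. finished \<F> h} = 1" if "k > N" for k
  proof -
    have "finished \<F> h" if "h \<in> set_pmf (run \<F> \<M> \<pi> k)" for h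
      using count[OF that] bound[OF Q[OF that]] \<open>k > N\<close> by auto
    then show ?thesis by (subst measure_pmf.prob_eq_1) (auto simp: AE_measure_pmf_iff)
  qed
  then show ?thesis
    unfolding finishes_almost_surely_def
    by (intro tendsto_eventually) (auto simp: eventually_sequentially intro!: exI[of _ "Suc N"])
qed

section \<open>Expected completion costs\<close>

lemma borel_measurable_completion_cost:
  assumes "\<F> \<subseteq> Pow {..<n}" "\<And>j. j < n \<Longrightarrow> (\<lambda>x. w x j) \<in> borel_measurable N"
  shows "(\<lambda>x. completion_cost \<F> S (w x)) \<in> borel_measurable N"
  unfolding completion_cost_def using assms
  by (intro borel_measurable_INF borel_measurable_sum)
     (auto intro!: countable_finite intro: finite_subset[of _ "Pow {..<n}"])

text \<open>Indices beyond \<open>n\<close> are replaced by a point mass, since the locale of product measures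
  constrains every factor.\<close>

definition law_family :: "nat \<Rightarrow> (nat \<Rightarrow> 's \<Rightarrow> real measure) \<Rightarrow> (nat \<Rightarrow> 's) \<Rightarrow> nat \<Rightarrow> real measure" where
  "law_family n law \<sigma> i = (if i < n then law i (\<sigma> i) else return borel 0)"

text \<open>Expectation of \<Phi> under the current conditional laws, with \<open>S\<close> already
  paid for. The cap \<open>b\<close> provides the boundedness in
  \<open>potential_le_expected_cost\<close>: the lower bound uses finite caps and lets them grow,
  the upper bound takes \<open>b = top\<close>.\<close>

definition potential ::
    "nat \<Rightarrow> nat set set \<Rightarrow> ennreal \<Rightarrow> (nat \<Rightarrow> 's \<Rightarrow> real measure) \<Rightarrow> (nat \<Rightarrow> 's \<Rightarrow> real \<Rightarrow> ennreal)
      \<Rightarrow> 's joint \<Rightarrow> ennreal" where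
  "potential n \<F> b law wt = (\<lambda>(\<sigma>, S).
     \<integral>\<^sup>+ x. min (completion_cost \<F> S (\<lambda>j. wt j (\<sigma> j) (x j))) b \<partial>PiM {..<n} (law_family n law \<sigma>))"

definition borel_prob :: "real measure \<Rightarrow> bool" where
  "borel_prob D \<longleftrightarrow> prob_space D \<and> sets D = sets borel"

lemma law_family_borel_prob:
  assumes "\<And>j. j < n \<Longrightarrow> borel_prob (law j (\<sigma> j))"
  shows "borel_prob (law_family n law \<sigma> j)"
  using assms by (auto simp: law_family_def borel_prob_def intro: prob_space_return)

context
  fixes n :: nat and \<F> :: "nat set set" and b :: ennreal
    and law :: "nat \<Rightarrow> 's \<Rightarrow> real measure" and wt :: "nat \<Rightarrow> 's \<Rightarrow> real \<Rightarrow> ennreal"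
  assumes \<F>: "\<F> \<subseteq> Pow {..<n}"
    and wt: "\<And>j s. wt j s \<in> borel_measurable borel"
begin

lemma finite_feasible: "finite \<F>" "\<And>T. T \<in> \<F> \<Longrightarrow> finite T"
  using \<F> by (auto intro: finite_subset[of _ "Pow {..<n}"] finite_subset[of _ "{..<n}"])

text \<open>The inner integral of the potential over coordinate \<open>i\<close>, the others being
  fixed at \<open>x\<close>. By Fubini a move of \<open>i\<close> changes only this factor.\<close>

definition slice :: "nat \<Rightarrow> (nat \<Rightarrow> 's) \<Rightarrow> nat set \<Rightarrow> 's \<Rightarrow> (nat \<Rightarrow> real) \<Rightarrow> ennreal" where
  "slice i \<sigma> S s x =
     (\<integral>\<^sup>+ y. min (completion_cost \<F> S ((\<lambda>j. wt j (\<sigma> j) (x j))(i := wt i s y))) b \<partial>law i s)"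

lemma slice_measurable:
  assumes \<sigma>: "\<And>j. j < n \<Longrightarrow> j \<noteq> i \<Longrightarrow> borel_prob (law j (\<sigma> j))" and s: "borel_prob (law i s)" and i: "i < n"
  shows "slice i \<sigma> S s \<in> borel_measurable (PiM ({..<n} - {i}) (law_family n law \<sigma>))"
proof -
  interpret prob_space "law i s" using s by (simp add: borel_prob_def)
  have sets: "sets (law i s) = sets borel" using s by (simp add: borel_prob_def)
  have 1: "(\<lambda>p. wt i s (snd p)) \<in> borel_measurable (PiM ({..<n} - {i}) (law_family n law \<sigma>) \<Otimes>\<^sub>M law i s)"
    using wt[of i s] sets by (intro measurable_compose[OF measurable_snd]) (simp cong: measurable_cong_sets)
  have 2: "(\<lambda>p. wt j (\<sigma> j) (fst p j)) \<in> borel_measurable (PiM ({..<n} - {i}) (law_family n law \<sigma>) \<Otimes>\<^sub>M law i s)"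
    if "j < n" "j \<noteq> i" for j
  proof -
    have sj: "sets (law_family n law \<sigma> j) = sets borel"
      using \<sigma>[OF that] that by (simp add: law_family_def borel_prob_def)
    have "(\<lambda>x. x j) \<in> measurable (PiM ({..<n} - {i}) (law_family n law \<sigma>)) (law_family n law \<sigma> j)"
      using that by (intro measurable_component_singleton) auto
    then have "(\<lambda>x. x j) \<in> measurable (PiM ({..<n} - {i}) (law_family n law \<sigma>)) borel"
      using sj by (simp cong: measurable_cong_sets)
    then show ?thesis
      by (intro measurable_compose[OF _ wt] measurable_compose[OF measurable_fst])
  qed
  have "(\<lambda>p. ((\<lambda>j. wt j (\<sigma> j) (fst p j))(i := wt i s (snd p))) j)
      \<in> borel_measurable (PiM ({..<n} - {i}) (law_family n law \<sigma>) \<Otimes>\<^sub>M law i s)" if "j < n" for j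
    using 1 2[OF that] by (cases "j = i") simp_all
  then have "(\<lambda>p. min (completion_cost \<F> S ((\<lambda>j. wt j (\<sigma> j) (fst p j))(i := wt i s (snd p)))) b)
      \<in> borel_measurable (PiM ({..<n} - {i}) (law_family n law \<sigma>) \<Otimes>\<^sub>M law i s)"
    by (intro borel_measurable_min borel_measurable_completion_cost[OF \<F>] borel_measurable_const)
  then show ?thesis
    unfolding slice_def by (intro borel_measurable_nn_integral) (simp only: split_beta')
qed

lemma integrand_measurable:
  assumes \<sigma>: "\<And>j. j < n \<Longrightarrow> borel_prob (law j (\<sigma> j))"
  shows "(\<lambda>x. min (completion_cost \<F> S (\<lambda>j. wt j (\<sigma> j) (x j))) b)
    \<in> borel_measurable (PiM {..<n} (law_family n law \<sigma>))"
proof (intro borel_measurable_min borel_measurable_completion_cost[OF \<F>] borel_measurable_const)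
  fix j assume "j < n"
  then have "(\<lambda>x. x j) \<in> measurable (PiM {..<n} (law_family n law \<sigma>)) (law_family n law \<sigma> j)"
    by (intro measurable_component_singleton) auto
  then have "(\<lambda>x. x j) \<in> measurable (PiM {..<n} (law_family n law \<sigma>)) borel"
    using law_family_borel_prob[of n law \<sigma> j, OF \<sigma>]
    by (simp add: borel_prob_def cong: measurable_cong_sets)
  then show "(\<lambda>x. wt j (\<sigma> j) (x j)) \<in> borel_measurable (PiM {..<n} (law_family n law \<sigma>))"
    by (rule measurable_compose[OF _ wt])
qed

lemma potential_slice:
  assumes \<sigma>: "\<And>j. j < n \<Longrightarrow> j \<noteq> i \<Longrightarrow> borel_prob (law j (\<sigma> j))" and s: "borel_prob (law i s)" and i: "i < n"
  shows "potential n \<F> b law wt (\<sigma>(i := s), S) =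
    (\<integral>\<^sup>+ x. slice i \<sigma> S s x \<partial>PiM ({..<n} - {i}) (law_family n law \<sigma>))"
proof -
  let ?L = "law_family n law (\<sigma>(i := s))"
  have bp: "borel_prob (?L j)" for j
    using \<sigma> s by (intro law_family_borel_prob) auto
  interpret product_sigma_finite ?L
    by (intro product_sigma_finite.intro prob_space_imp_sigma_finite bp[unfolded borel_prob_def, THEN conjunct1])
  have ins: "insert i ({..<n} - {i}) = {..<n}" using i by auto
  have meas: "(\<lambda>x. min (completion_cost \<F> S (\<lambda>j. wt j ((\<sigma>(i := s)) j) (x j))) b)
      \<in> borel_measurable (PiM {..<n} ?L)"
    using \<sigma> s by (intro integrand_measurable) auto
  have P: "PiM ({..<n} - {i}) ?L = PiM ({..<n} - {i}) (law_family n law \<sigma>)"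
    by (intro PiM_cong) (auto simp: law_family_def)
  have "potential n \<F> b law wt (\<sigma>(i := s), S) = (\<integral>\<^sup>+ x. (\<integral>\<^sup>+ y. min (completion_cost \<F> S
      (\<lambda>j. wt j ((\<sigma>(i := s)) j) ((x(i := y)) j))) b \<partial>?L i) \<partial>PiM ({..<n} - {i}) ?L)"
    unfolding potential_def prod.case
    using product_nn_integral_insert[of "{..<n} - {i}" i, unfolded ins, OF _ _ meas] by simp
  also have "\<dots> = (\<integral>\<^sup>+ x. slice i \<sigma> S s x \<partial>PiM ({..<n} - {i}) (law_family n law \<sigma>))"
  proof -
    have "(\<lambda>j. wt j ((\<sigma>(i := s)) j) ((x(i := y)) j)) = (\<lambda>j. wt j (\<sigma> j) (x j))(i := wt i s y)" for x y
      by auto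
    then show ?thesis unfolding P slice_def using i by (simp add: law_family_def)
  qed
  finally show ?thesis .
qed

lemma prob_space_rest:
  assumes \<sigma>: "\<And>j. j < n \<Longrightarrow> j \<noteq> i \<Longrightarrow> borel_prob (law j (\<sigma> j))"
  shows "prob_space (PiM ({..<n} - {i}) (law_family n law \<sigma>))"
proof (rule prob_space_PiM)
  fix j assume "j \<in> {..<n} - {i}"
  then show "prob_space (law_family n law \<sigma> j)" using \<sigma> by (auto simp: law_family_def borel_prob_def)
qed

text \<open>Finite support turns the average over \<open>s\<close> into a finite sum, which can be
  exchanged with the integral without joint measurability in \<open>s\<close>.\<close>

lemma potential_slice_pmf:
  assumes \<sigma>: "\<And>j. j < n \<Longrightarrow> j \<noteq> i \<Longrightarrow> borel_prob (law j (\<sigma> j))" and i: "i < n"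
    and p: "finite (set_pmf p)" "\<And>s. s \<in> set_pmf p \<Longrightarrow> borel_prob (law i s)"
  shows "(\<integral>\<^sup>+ s. potential n \<F> b law wt (\<sigma>(i := s), S) \<partial>measure_pmf p) =
    (\<integral>\<^sup>+ x. (\<integral>\<^sup>+ s. slice i \<sigma> S s x \<partial>measure_pmf p) \<partial>PiM ({..<n} - {i}) (law_family n law \<sigma>))"
    and "(\<lambda>x. \<integral>\<^sup>+ s. slice i \<sigma> S s x \<partial>measure_pmf p) \<in> borel_measurable (PiM ({..<n} - {i}) (law_family n law \<sigma>))"
proof -
  note m = slice_measurable[OF \<sigma> _ i]
  show "(\<lambda>x. \<integral>\<^sup>+ s. slice i \<sigma> S s x \<partial>measure_pmf p) \<in> borel_measurable (PiM ({..<n} - {i}) (law_family n law \<sigma>))"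
    using p m by (simp add: nn_integral_measure_pmf_finite)
  show "(\<integral>\<^sup>+ s. potential n \<F> b law wt (\<sigma>(i := s), S) \<partial>measure_pmf p) =
    (\<integral>\<^sup>+ x. (\<integral>\<^sup>+ s. slice i \<sigma> S s x \<partial>measure_pmf p) \<partial>PiM ({..<n} - {i}) (law_family n law \<sigma>))"
    using p m by (simp add: nn_integral_measure_pmf_finite nn_integral_sum nn_integral_multc
        potential_slice[OF \<sigma> _ i])
qed

text \<open>With the other coordinates fixed, the completion cost is \<open>min (A + y) B\<close> in
  the weight \<open>y\<close> of \<open>i\<close>. An estimate for one alternative, uniform in
  \<open>A\<close> and \<open>B\<close>, therefore carries over to the potential.\<close>

lemma potential_step_lower:
  assumes \<sigma>: "\<And>j. j < n \<Longrightarrow> borel_prob (law j (\<sigma> j))" and i: "i < n"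
    and p: "finite (set_pmf p)" "\<And>s. s \<in> set_pmf p \<Longrightarrow> borel_prob (law i s)"
    and step: "\<And>A B. (\<integral>\<^sup>+ y. min (A + wt i (\<sigma> i) y) B \<partial>law i (\<sigma> i))
      \<le> K + (\<integral>\<^sup>+ s. (\<integral>\<^sup>+ y. min (A + wt i s y) B \<partial>law i s) \<partial>measure_pmf p)"
  shows "potential n \<F> b law wt (\<sigma>, S) \<le> K + (\<integral>\<^sup>+ s. potential n \<F> b law wt (\<sigma>(i := s), S) \<partial>measure_pmf p)"
proof -
  let ?P = "PiM ({..<n} - {i}) (law_family n law \<sigma>)"
  interpret P: prob_space ?P using \<sigma> by (intro prob_space_rest)
  have "slice i \<sigma> S (\<sigma> i) x \<le> K + (\<integral>\<^sup>+ s. slice i \<sigma> S s x \<partial>measure_pmf p)" for x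
  proof -
    obtain A B where "\<And>y. completion_cost \<F> S ((\<lambda>j. wt j (\<sigma> j) (x j))(i := y)) = min (A + y) B"
      using completion_cost_upd_ex[OF finite_feasible] by blast
    \<comment> \<open>The cap \<open>b\<close> is absorbed into \<open>B\<close>.\<close>
    then show ?thesis
      unfolding slice_def using step[of A "min B b"] by (simp add: min.assoc)
  qed
  then have "potential n \<F> b law wt (\<sigma>, S) \<le> (\<integral>\<^sup>+ x. K + (\<integral>\<^sup>+ s. slice i \<sigma> S s x \<partial>measure_pmf p) \<partial>?P)"
    using potential_slice[of i \<sigma> "\<sigma> i" S] \<sigma> i by (auto intro!: nn_integral_mono)
  also have "\<dots> = K + (\<integral>\<^sup>+ s. potential n \<F> b law wt (\<sigma>(i := s), S) \<partial>measure_pmf p)"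
    using potential_slice_pmf[OF \<sigma> i p, of S] P.emeasure_space_1 by (subst nn_integral_add) auto
  finally show ?thesis .
qed

text \<open>Selecting \<open>i\<close> at the known price \<open>v\<close> is one way to complete
  \<open>S\<close>, so \<Phi> falls by at most \<open>v\<close>; the cap respects this because
  \<open>b \<le> v + b\<close>.\<close>

lemma potential_select_lower:
  assumes \<sigma>: "\<And>j. j < n \<Longrightarrow> borel_prob (law j (\<sigma> j))" and i: "i \<notin> S" and wi: "\<And>y. wt i (\<sigma> i) y = v"
  shows "potential n \<F> b law wt (\<sigma>, S) \<le> v + potential n \<F> b law wt (\<sigma>, insert i S)"
proof -
  let ?P = "PiM {..<n} (law_family n law \<sigma>)"
  have bp: "borel_prob (law_family n law \<sigma> j)" for j by (intro law_family_borel_prob \<sigma>)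
  interpret P: prob_space ?P
    using bp by (intro prob_space_PiM) (simp add: borel_prob_def)
  note meas = integrand_measurable[where \<sigma>=\<sigma> and S="insert i S", OF \<sigma>]
  have "min (completion_cost \<F> S (\<lambda>j. wt j (\<sigma> j) (x j))) b
      \<le> v + min (completion_cost \<F> (insert i S) (\<lambda>j. wt j (\<sigma> j) (x j))) b" for x
  proof -
    have "completion_cost \<F> S (\<lambda>j. wt j (\<sigma> j) (x j))
        \<le> v + completion_cost \<F> (insert i S) (\<lambda>j. wt j (\<sigma> j) (x j))"
      by (simp add: completion_cost_select[OF finite_feasible i, of "\<lambda>j. wt j (\<sigma> j) (x j)"] wi add.commute)
    moreover have "b \<le> v + b" by (simp add: add_increasing)
    ultimately show ?thesis by (auto simp: min_def intro: order_trans)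
  qed
  then have "potential n \<F> b law wt (\<sigma>, S) \<le>
      (\<integral>\<^sup>+ x. v + min (completion_cost \<F> (insert i S) (\<lambda>j. wt j (\<sigma> j) (x j))) b \<partial>?P)"
    unfolding potential_def prod.case by (intro nn_integral_mono)
  also have "\<dots> = v + potential n \<F> b law wt (\<sigma>, insert i S)"
    unfolding potential_def prod.case using meas P.emeasure_space_1 by (subst nn_integral_add) auto
  finally show ?thesis .
qed

end

text \<open>Counterpart of \<open>potential_step_lower\<close> for a greedily chosen
  \<open>i\<close>: the other eligible alternatives weigh at least \<theta>, so
  \<open>avoiding_cost_ge\<close> reduces the claim to pairs with
  \<open>A + \<theta> \<le> B\<close>. \<open>K\<close> will hold the payment together with the
  remaining debt, \<open>R\<close> the old debt.\<close>

lemma potential_step_upper: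
  assumes mat: "matroid {..<n} \<I>" and wt: "\<And>j s. wt j s \<in> borel_measurable borel"
    and \<sigma>: "\<And>j. j < n \<Longrightarrow> borel_prob (law j (\<sigma> j))" and i: "i < n" "i \<notin> S" "insert i S \<in> \<I>"
    and p: "finite (set_pmf p)" "\<And>s. s \<in> set_pmf p \<Longrightarrow> borel_prob (law i s)"
    and \<theta>: "\<And>j y. j \<notin> S \<Longrightarrow> j \<noteq> i \<Longrightarrow> insert j S \<in> \<I> \<Longrightarrow> \<theta> \<le> wt j (\<sigma> j) y"
    and step: "\<And>A B. A + \<theta> \<le> B \<Longrightarrow>
      K + (\<integral>\<^sup>+ s. (\<integral>\<^sup>+ y. min (A + wt i s y) B \<partial>law i s) \<partial>measure_pmf p)
      \<le> R + (\<integral>\<^sup>+ y. min (A + wt i (\<sigma> i) y) B \<partial>law i (\<sigma> i))"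
  shows "K + (\<integral>\<^sup>+ s. potential n (basis_supersets {..<n} \<I>) top law wt (\<sigma>(i := s), S) \<partial>measure_pmf p)
    \<le> R + potential n (basis_supersets {..<n} \<I>) top law wt (\<sigma>, S)"
proof -
  let ?P = "PiM ({..<n} - {i}) (law_family n law \<sigma>)" and ?\<F> = "basis_supersets {..<n} \<I>"
  have \<F>: "?\<F> \<subseteq> Pow {..<n}" by (auto simp: basis_supersets_def)
  note fin = finite_feasible[OF \<F> wt]
  interpret P: prob_space ?P using \<sigma> by (intro prob_space_rest[OF \<F> wt])
  let ?slice = "slice ?\<F> top law wt i \<sigma> S"
  have step': "K + (\<integral>\<^sup>+ s. ?slice s x \<partial>measure_pmf p) \<le> R + ?slice (\<sigma> i) x" for x
  proof -
    let ?w = "\<lambda>j. wt j (\<sigma> j) (x j)"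
    have "completion_cost ?\<F> (insert i S) ?w + \<theta> \<le> avoiding_cost ?\<F> S i ?w"
      using \<theta> by (intro avoiding_cost_ge[OF mat i(3,2)]) auto
    from step[OF this] show ?thesis
      unfolding slice_def[OF \<F> wt] by (simp add: completion_cost_upd[OF fin i(2)])
  qed
  have "K + (\<integral>\<^sup>+ s. potential n ?\<F> top law wt (\<sigma>(i := s), S) \<partial>measure_pmf p)
      = (\<integral>\<^sup>+ x. K + (\<integral>\<^sup>+ s. ?slice s x \<partial>measure_pmf p) \<partial>?P)"
    using potential_slice_pmf[where law=law and wt=wt and \<sigma>=\<sigma> and b=top and S=S, OF \<F> wt \<sigma> i(1) p] P.emeasure_space_1
    by (subst nn_integral_add) auto
  also have "\<dots> \<le> (\<integral>\<^sup>+ x. R + ?slice (\<sigma> i) x \<partial>?P)"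
    by (intro nn_integral_mono step')
  also have "\<dots> = R + potential n ?\<F> top law wt (\<sigma>, S)"
    using slice_measurable[where law=law and wt=wt and \<sigma>=\<sigma> and b=top and S=S, OF \<F> wt \<sigma> \<sigma>[OF i(1)] i(1)]
      potential_slice[where law=law and wt=wt and \<sigma>=\<sigma> and b=top and S=S, OF \<F> wt \<sigma> \<sigma>[OF i(1)] i(1)] P.emeasure_space_1
    by (subst nn_integral_add) auto
  finally show ?thesis .
qed

text \<open>For a cheapest alternative the minimum is attained by the branch that selects it, so
  \<Phi> falls by exactly \<open>v\<close>.\<close>

lemma potential_select_upper:
  assumes mat: "matroid {..<n} \<I>" and wt: "\<And>j s. wt j s \<in> borel_measurable borel"
    and \<sigma>: "\<And>j. j < n \<Longrightarrow> borel_prob (law j (\<sigma> j))" and i: "i \<notin> S" "insert i S \<in> \<I>"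
    and wi: "\<And>y. wt i (\<sigma> i) y = v"
    and \<theta>: "\<And>j y. j \<notin> S \<Longrightarrow> j \<noteq> i \<Longrightarrow> insert j S \<in> \<I> \<Longrightarrow> v \<le> wt j (\<sigma> j) y"
  shows "v + potential n (basis_supersets {..<n} \<I>) top law wt (\<sigma>, insert i S)
    \<le> potential n (basis_supersets {..<n} \<I>) top law wt (\<sigma>, S)"
proof -
  let ?P = "PiM {..<n} (law_family n law \<sigma>)" and ?\<F> = "basis_supersets {..<n} \<I>"
  have \<F>: "?\<F> \<subseteq> Pow {..<n}" by (auto simp: basis_supersets_def)
  interpret P: prob_space ?P
    by (intro prob_space_PiM law_family_borel_prob[of n law \<sigma>, OF \<sigma>, unfolded borel_prob_def, THEN conjunct1])
  have pt: "v + completion_cost ?\<F> (insert i S) (\<lambda>j. wt j (\<sigma> j) (x j))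
      = completion_cost ?\<F> S (\<lambda>j. wt j (\<sigma> j) (x j))" for x
  proof -
    let ?w = "\<lambda>j. wt j (\<sigma> j) (x j)"
    have "completion_cost ?\<F> (insert i S) ?w + v \<le> avoiding_cost ?\<F> S i ?w"
      using \<theta> by (intro avoiding_cost_ge[OF mat i(2,1)]) auto
    then show ?thesis
      by (simp add: completion_cost_select[OF finite_feasible[OF \<F> wt] i(1), of ?w] wi add.commute min_absorb1)
  qed
  have "v + potential n ?\<F> top law wt (\<sigma>, insert i S)
      = (\<integral>\<^sup>+ x. v + completion_cost ?\<F> (insert i S) (\<lambda>j. wt j (\<sigma> j) (x j)) \<partial>?P)"
    using integrand_measurable[where law=law and wt=wt and \<sigma>=\<sigma> and b=top and S="insert i S", OF \<F> wt \<sigma>] P.emeasure_space_1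
    unfolding potential_def prod.case by (subst nn_integral_add) auto
  then show ?thesis by (simp add: pt potential_def)
qed

section \<open>Lower bound on the optimum\<close>

lemma borel_prob_uniform_measure:
  assumes "borel_prob D" "emeasure D A \<noteq> 0"
  shows "borel_prob (uniform_measure D A)"
proof -
  interpret prob_space D using assms by (simp add: borel_prob_def)
  show ?thesis using assms prob_space_uniform_measure[of D A] by (simp add: borel_prob_def)
qed

lemma finite_set_pmf_ws_trans: "finite (set_pmf (ws_trans s a))"
  by (cases a) auto

lemma ws_trans_borel_prob:
  assumes s: "borel_prob (ws_law s)" and s': "s' \<in> set_pmf (ws_trans s a)"
  shows "borel_prob (ws_law s')"
proof (cases a)
  case (Weigh t)
  interpret prob_space "ws_law s" using s by (simp add: borel_prob_def)
  have meas: "{..t} \<in> sets (ws_law s)" "space (ws_law s) = UNIV"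
    using s sets_eq_imp_space_eq[of "ws_law s" borel] by (auto simp: borel_prob_def)
  obtain u where u: "u \<in> set_pmf (bernoulli_pmf (prob {..t}))"
    "s' = Open (uniform_measure (ws_law s) (if u then {..t} else {t<..}))"
    using s' Weigh by auto
  have "prob {t<..} = 1 - prob {..t}"
    using prob_compl[OF meas(1)] meas(2) by (simp add: Compl_eq_Diff_UNIV[symmetric] ac_simps)
  \<comment> \<open>An outcome in the support has positive probability, so its conditional law is a
    probability measure.\<close>
  then have "prob (if u then {..t} else {t<..}) \<noteq> 0"
    using u(1) by (cases u) (auto simp: set_pmf_iff)
  then show ?thesis
    using u(2) s by (auto intro!: borel_prob_uniform_measure simp: emeasure_eq_measure)
next
  case Stop
  then show ?thesis using s s' by simp
qed

text \<open>Multiplying by the mass of \<open>A\<close> covers null events too, where both sides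
  vanish.\<close>

lemma nn_integral_uniform_measure_times:
  assumes D: "borel_prob D" and A: "A \<in> sets borel" and F: "F \<in> borel_measurable borel"
  shows "(\<integral>\<^sup>+ x. F x \<partial>uniform_measure D A) * emeasure D A = (\<integral>\<^sup>+ x. F x * indicator A x \<partial>D)"
proof -
  interpret prob_space D using D by (simp add: borel_prob_def)
  have sets: "sets D = sets borel" using D by (simp add: borel_prob_def)
  then have A': "A \<in> sets D" and F': "F \<in> borel_measurable D"
    using A F by (simp_all cong: measurable_cong_sets)
  show ?thesis
  proof (cases "emeasure D A = 0")
    case True
    then have "AE x in D. x \<notin> A" using A' by (simp add: AE_iff_null_sets null_sets_def AE_not_in)
    then have "(\<integral>\<^sup>+ x. F x * indicator A x \<partial>D) = (\<integral>\<^sup>+ x. 0 \<partial>D)"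
      by (intro nn_integral_cong_AE) auto
    then show ?thesis using True by simp
  next
    case False
    then show ?thesis
      using nn_integral_uniform_measure[OF F' A'] by (simp add: ennreal_divide_times ennreal_divide_self less_top[symmetric])
  qed
qed

text \<open>Total expectation: the two conditional laws mix back to the old law. A weighing thus
  affects the potential only through the change of the weight function.\<close>

lemma nn_integral_weigh:
  assumes s: "borel_prob (ws_law s)" and F: "F \<in> borel_measurable borel"
  shows "(\<integral>\<^sup>+ s'. (\<integral>\<^sup>+ x. F x \<partial>ws_law s') \<partial>measure_pmf (ws_trans s (Weigh t))) = (\<integral>\<^sup>+ x. F x \<partial>ws_law s)"
proof -
  let ?D = "ws_law s"
  interpret prob_space ?D using s by (simp add: borel_prob_def)
  have sets: "sets ?D = sets borel" and space: "space ?D = UNIV"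
    using s sets_eq_imp_space_eq[of ?D borel] by (auto simp: borel_prob_def)
  have F': "F \<in> borel_measurable ?D" using F sets by (simp cong: measurable_cong_sets)
  have compl: "1 - prob {..t} = prob {t<..}"
    using prob_compl[of "{..t}"] sets space by (simp add: Compl_eq_Diff_UNIV[symmetric] ac_simps)
  have "(\<integral>\<^sup>+ s'. (\<integral>\<^sup>+ x. F x \<partial>ws_law s') \<partial>measure_pmf (ws_trans s (Weigh t))) =
      (\<integral>\<^sup>+ x. F x \<partial>uniform_measure ?D {..t}) * emeasure ?D {..t}
      + (\<integral>\<^sup>+ x. F x \<partial>uniform_measure ?D {t<..}) * emeasure ?D {t<..}"
    by (simp add: compl emeasure_eq_measure)
  also have "\<dots> = (\<integral>\<^sup>+ x. F x * indicator {..t} x + F x * indicator {t<..} x \<partial>?D)"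
    using F' sets by (simp add: nn_integral_uniform_measure_times[OF s _ F] nn_integral_add)
  also have "\<dots> = (\<integral>\<^sup>+ x. F x \<partial>?D)"
    by (intro nn_integral_cong) (auto simp: indicator_def)
  finally show ?thesis .
qed

text \<open>
  The weight of an alternative that has not been weighed is \<open>max X g\<close>; its excess
  \<open>(g - X)\<^sup>+\<close> over \<open>X\<close> has mean at most \<open>c\<close>, so it is paid for by the
  first weighing.  If \<open>g\<close> is at most the mean, then \<open>max X g\<close> has at most twice the
  mean of \<open>X\<close>, hence the factor 2 for terminal states.
\<close>

fun ws_weight :: "real measure \<Rightarrow> real \<Rightarrow> ws_state \<Rightarrow> real \<Rightarrow> ennreal" where
  "ws_weight D g (Open D') x = (if D' = D then max (ennreal x) (ennreal g) else ennreal x)"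
| "ws_weight D g (Closed D') x = 2 * (\<integral>\<^sup>+ y. ennreal y \<partial>D')"

lemma ws_weight_measurable: "ws_weight D g s \<in> borel_measurable borel"
proof (cases s)
  case (Open D')
  then have "ws_weight D g s = (\<lambda>x. if D' = D then max (ennreal x) (ennreal g) else ennreal x)" by auto
  then show ?thesis by simp
next
  case (Closed D')
  then have "ws_weight D g s = (\<lambda>x. 2 * (\<integral>\<^sup>+ y. ennreal y \<partial>D'))" by auto
  then show ?thesis by simp
qed

text \<open>One-alternative estimate for the lower bound. Stopping replaces the weight by twice the
  mean, and concavity of \<open>min (A + y) B\<close> in \<open>y\<close> handles the averaging.
  Weighing may remove the floor, which loses at most the positive part of \<open>g - y\<close>; the
  rest is preserved by total expectation.\<close>

lemma ws_weight_step:
  assumes D': "borel_prob D'"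
    and g: "ennreal g \<le> (\<integral>\<^sup>+ x. ennreal x \<partial>D)"
    and c: "(\<integral>\<^sup>+ x. ennreal (g - x) \<partial>D) \<le> ennreal c"
  shows "(\<integral>\<^sup>+ y. min (A + ws_weight D g (Open D') y) B \<partial>D') \<le> 2 * ws_cost c a
    + (\<integral>\<^sup>+ s. (\<integral>\<^sup>+ y. min (A + ws_weight D g s y) B \<partial>ws_law s) \<partial>measure_pmf (ws_trans (Open D') a))"
proof -
  interpret D': prob_space D' using D' by (simp add: borel_prob_def)
  have sets[measurable_cong]: "sets D' = sets borel" using D' by (simp add: borel_prob_def)
  show ?thesis
  proof (cases a)
    case Stop
    have "(\<integral>\<^sup>+ y. ws_weight D g (Open D') y \<partial>D') \<le> 2 * (\<integral>\<^sup>+ y. ennreal y \<partial>D')"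
    proof (cases "D' = D")
      case True
      have "(\<integral>\<^sup>+ y. ws_weight D g (Open D') y \<partial>D') \<le> (\<integral>\<^sup>+ y. ennreal y + ennreal g \<partial>D')"
        using True by (intro nn_integral_mono) (auto simp: max_def add_increasing add_increasing2)
      also have "\<dots> = (\<integral>\<^sup>+ y. ennreal y \<partial>D') + ennreal g"
        by (subst nn_integral_add) (auto simp: D'.emeasure_space_1)
      also have "\<dots> \<le> (\<integral>\<^sup>+ y. ennreal y \<partial>D') + (\<integral>\<^sup>+ y. ennreal y \<partial>D')"
        using g True by (intro add_left_mono) simp
      finally show ?thesis by (simp add: mult_2)
    next
      case False
      then show ?thesis by (simp add: mult_2 add_increasing)
    qed
    moreover have "(\<integral>\<^sup>+ y. min (A + ws_weight D g (Open D') y) B \<partial>D')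
        \<le> A + (\<integral>\<^sup>+ y. ws_weight D g (Open D') y \<partial>D')"
    proof -
      have [measurable]: "ws_weight D g (Open D') \<in> borel_measurable D'"
        using ws_weight_measurable[of D g "Open D'"] sets by (simp cong: measurable_cong_sets)
      have "(\<integral>\<^sup>+ y. min (A + ws_weight D g (Open D') y) B \<partial>D')
          \<le> (\<integral>\<^sup>+ y. A + ws_weight D g (Open D') y \<partial>D')"
        by (intro nn_integral_mono) simp
      also have "\<dots> = A + (\<integral>\<^sup>+ y. ws_weight D g (Open D') y \<partial>D')"
        by (subst nn_integral_add) (measurable, simp add: D'.emeasure_space_1)
      finally show ?thesis .
    qed
    moreover have "(\<integral>\<^sup>+ y. min (A + ws_weight D g (Open D') y) B \<partial>D') \<le> B"
    proof -
      have "(\<integral>\<^sup>+ y. min (A + ws_weight D g (Open D') y) B \<partial>D') \<le> (\<integral>\<^sup>+ y. B \<partial>D')"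
        by (intro nn_integral_mono) simp
      then show ?thesis by (simp add: D'.emeasure_space_1)
    qed
    ultimately have "(\<integral>\<^sup>+ y. min (A + ws_weight D g (Open D') y) B \<partial>D')
        \<le> min (A + 2 * (\<integral>\<^sup>+ y. ennreal y \<partial>D')) B"
      by (meson add_left_mono min.boundedI order_trans)
    then show ?thesis using Stop by (simp add: D'.emeasure_space_1)
  next
    case (Weigh t)
    have F: "(\<lambda>y. min (A + ennreal y) B) \<in> borel_measurable borel" by simp
    have "(\<integral>\<^sup>+ y. min (A + ws_weight D g (Open D') y) B \<partial>D')
        \<le> ennreal c + (\<integral>\<^sup>+ y. min (A + ennreal y) B \<partial>D')"
    proof (cases "D' = D")
      case True
      have pt: "min (A + max (ennreal y) (ennreal g)) B \<le> ennreal (g - y) + min (A + ennreal y) B" for y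
      proof -
        have "max (ennreal y) (ennreal g) \<le> ennreal (g - y) + ennreal y"
          by (cases "0 \<le> y"; cases "y \<le> g")
             (auto simp: ennreal_plus[symmetric] ennreal_neg not_le intro!: ennreal_leI add_increasing add_increasing2 simp del: ennreal_plus)
        then have "A + max (ennreal y) (ennreal g) \<le> ennreal (g - y) + (A + ennreal y)"
          by (metis add.left_commute add_left_mono)
        then show ?thesis
          by (auto simp: min_def not_le intro: order_trans add_increasing less_imp_le)
      qed
      have "(\<integral>\<^sup>+ y. min (A + ws_weight D g (Open D') y) B \<partial>D')
          \<le> (\<integral>\<^sup>+ y. ennreal (g - y) + min (A + ennreal y) B \<partial>D')"
        using True pt by (intro nn_integral_mono) simp
      also have "\<dots> = (\<integral>\<^sup>+ y. ennreal (g - y) \<partial>D') + (\<integral>\<^sup>+ y. min (A + ennreal y) B \<partial>D')"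
        by (intro nn_integral_add) measurable
      also have "\<dots> \<le> ennreal c + (\<integral>\<^sup>+ y. min (A + ennreal y) B \<partial>D')"
        using c True by (intro add_right_mono) simp
      finally show ?thesis .
    next
      case False
      then show ?thesis by (simp add: add_increasing)
    qed
    also have "(\<integral>\<^sup>+ y. min (A + ennreal y) B \<partial>D')
        = (\<integral>\<^sup>+ s. (\<integral>\<^sup>+ y. min (A + ennreal y) B \<partial>ws_law s) \<partial>measure_pmf (ws_trans (Open D') a))"
      using nn_integral_weigh[of "Open D'", OF _ F] D' Weigh by simp
    also have "\<dots> \<le> (\<integral>\<^sup>+ s. (\<integral>\<^sup>+ y. min (A + ws_weight D g s y) B \<partial>ws_law s) \<partial>measure_pmf (ws_trans (Open D') a))"
    proof (intro nn_integral_mono_AE, unfold AE_measure_pmf_iff, intro ballI nn_integral_mono)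
      \<comment> \<open>An uninformative weighing may return the law \<open>D\<close> and so keep
        the floor; only the lower bound \<open>y\<close> on the new weight is used.\<close>
      fix s y assume "s \<in> set_pmf (ws_trans (Open D') a)"
      then have "ennreal y \<le> ws_weight D g s y" using Weigh by auto
      then show "min (A + ennreal y) B \<le> min (A + ws_weight D g s y) B"
        by (intro min.mono add_left_mono) auto
    qed
    finally show ?thesis
      using Weigh by (simp add: mult_2 add.assoc add_increasing)
  qed
qed

text \<open>For each policy the bound is first shown with a finite cap; monotone convergence then
  removes the cap.\<close>

lemma ws_opt_cost_lower_bound:
  assumes \<F>: "\<F> \<subseteq> Pow {..<n}" and D: "\<And>i. i < n \<Longrightarrow> borel_prob (D i)"
    and g: "\<And>i. i < n \<Longrightarrow> ennreal (g i) \<le> (\<integral>\<^sup>+ x. ennreal x \<partial>D i)"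
    and c: "\<And>i. i < n \<Longrightarrow> (\<integral>\<^sup>+ x. ennreal (g i - x) \<partial>D i) \<le> ennreal (c i)"
  shows "potential n \<F> top (\<lambda>_. ws_law) (\<lambda>i. ws_weight (D i) (g i)) (\<lambda>i. Open (D i), {})
    \<le> 2 * opt_cost n \<F> (\<lambda>i. ws_mdp (D i) (c i))"
proof -
  let ?\<M> = "\<lambda>i. ws_mdp (D i) (c i)" and ?wt = "\<lambda>i. ws_weight (D i) (g i)"
  let ?V = "\<lambda>b. potential n \<F> b (\<lambda>_. ws_law) ?wt"
  let ?init = "(\<lambda>i. Open (D i), {})"
  let ?Q = "\<lambda>st :: ws_state joint. \<forall>j<n. borel_prob (ws_law (fst st j))"
  have start: "(\<lambda>i. start (?\<M> i), {}) = ?init" by (simp add: ws_mdp_def)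
  note meas = integrand_measurable[OF \<F> ws_weight_measurable]
  have bounded: "?V (ennreal (real b)) ?init \<le> 2 * expected_cost n \<F> ?\<M> \<pi>"
    if fas: "finishes_almost_surely \<F> ?\<M> \<pi>" for b :: nat and \<pi>
    unfolding start[symmetric]
  proof (rule potential_le_expected_cost[where Q = ?Q and b = "real b"])
    show "?Q (\<lambda>i. start (?\<M> i), {})" using D by (simp add: ws_mdp_def)
  next
    fix st m s assume Q: "?Q st" and s: "s \<in> set_pmf (move_result ?\<M> st m)"
    then show "?Q s"
      by (cases st; cases m) (auto simp: ws_mdp_def, metis ws_trans_borel_prob)
  next
    fix st m assume Q: "?Q st" and leg: "legal n ?\<M> st m"
    obtain \<sigma> S where st: "st = (\<sigma>, S)" by force
    have \<sigma>: "borel_prob (ws_law (\<sigma> j))" if "j < n" for j using Q st that by simp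
    show "?V (ennreal (real b)) st \<le> 2 * move_cost ?\<M> st m
        + (\<integral>\<^sup>+ s. ?V (ennreal (real b)) s \<partial>measure_pmf (move_result ?\<M> st m))"
    proof (cases m)
      case (Act i a)
      then have i: "i < n" using leg st by simp
      obtain D' where D': "\<sigma> i = Open D'" using leg st Act by (cases "\<sigma> i") (auto simp: ws_mdp_def)
      have "?V (ennreal (real b)) (\<sigma>, S) \<le> 2 * ws_cost (c i) a
          + (\<integral>\<^sup>+ s. ?V (ennreal (real b)) (\<sigma>(i := s), S) \<partial>measure_pmf (ws_trans (\<sigma> i) a))"
      proof (rule potential_step_lower[where law = "\<lambda>_. ws_law" and \<sigma> = \<sigma>
            and wt = ?wt, OF \<F> ws_weight_measurable \<sigma> i finite_set_pmf_ws_trans])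
        show "borel_prob (ws_law s)" if "s \<in> set_pmf (ws_trans (\<sigma> i) a)" for s
          using ws_trans_borel_prob[OF \<sigma>[OF i] that] .
      next
        fix A B
        show "(\<integral>\<^sup>+ y. min (A + ws_weight (D i) (g i) (\<sigma> i) y) B \<partial>ws_law (\<sigma> i)) \<le> 2 * ws_cost (c i) a
          + (\<integral>\<^sup>+ s. (\<integral>\<^sup>+ y. min (A + ws_weight (D i) (g i) s y) B \<partial>ws_law s) \<partial>measure_pmf (ws_trans (\<sigma> i) a))"
          using ws_weight_step[OF _ g[OF i] c[OF i], of D' A B a] \<sigma>[OF i] D' by simp
      qed
      then show ?thesis using st Act by (simp add: ws_mdp_def)
    next
      case (Select i)
      then obtain D' where D': "\<sigma> i = Closed D'" and i: "i \<notin> S" using leg st by (auto simp: ws_mdp_def)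
      have "?V (ennreal (real b)) (\<sigma>, S) \<le> 2 * (\<integral>\<^sup>+ y. ennreal y \<partial>D') + ?V (ennreal (real b)) (\<sigma>, insert i S)"
        by (rule potential_select_lower[where law = "\<lambda>_. ws_law" and \<sigma> = \<sigma>
            and wt = ?wt, OF \<F> ws_weight_measurable \<sigma> i]) (simp_all add: D')
      then show ?thesis using st Select D' by (simp add: ws_mdp_def)
    qed
  next
    fix \<sigma> S assume "S \<in> \<F>"
    then show "?V (ennreal (real b)) (\<sigma>, S) = 0"
      by (simp add: potential_def completion_cost_feasible)
  next
    fix st assume Q: "?Q st"
    obtain \<sigma> S where st: "st = (\<sigma>, S)" by force
    interpret prob_space "PiM {..<n} (law_family n (\<lambda>_. ws_law) \<sigma>)"
      using Q st by (intro prob_space_PiM law_family_borel_prob[of n "\<lambda>_. ws_law" \<sigma>, unfolded borel_prob_def, THEN conjunct1])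
         (auto simp: borel_prob_def)
    have "?V (ennreal (real b)) st \<le> (\<integral>\<^sup>+ x. ennreal (real b) \<partial>PiM {..<n} (law_family n (\<lambda>_. ws_law) \<sigma>))"
      unfolding potential_def st prod.case by (intro nn_integral_mono) simp
    then show "?V (ennreal (real b)) st \<le> ennreal (real b)" by (simp add: emeasure_space_1)
  qed (use fas in auto)
  have "?V top ?init = (SUP b. ?V (ennreal (real b)) ?init)"
  proof -
    let ?P = "PiM {..<n} (law_family n (\<lambda>_. ws_law) (\<lambda>i. Open (D i)))"
    let ?\<Phi> = "\<lambda>x. completion_cost \<F> {} (\<lambda>j. ?wt j (Open (D j)) (x j))"
    have "(SUP b. min (?\<Phi> x) (ennreal (real b))) = ?\<Phi> x" for x
      unfolding inf_min[symmetric] inf_SUP[symmetric]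
      by (simp add: ennreal_of_nat_eq_real_of_nat[symmetric] ennreal_SUP_of_nat_eq_top)
    then have "?V top ?init = (\<integral>\<^sup>+ x. (SUP b. min (?\<Phi> x) (ennreal (real b))) \<partial>?P)"
      by (simp add: potential_def)
    also have "\<dots> = (SUP b. \<integral>\<^sup>+ x. min (?\<Phi> x) (ennreal (real b)) \<partial>?P)"
      using D by (intro nn_integral_monotone_convergence_SUP meas)
        (auto simp: incseq_def le_fun_def min_le_iff_disj)
    finally show ?thesis by (simp add: potential_def)
  qed
  then have "?V top ?init \<le> 2 * expected_cost n \<F> ?\<M> \<pi>" if "finishes_almost_surely \<F> ?\<M> \<pi>" for \<pi>
    using bounded[OF that] by (simp add: SUP_le_iff)
  then have "?V top ?init / 2 \<le> opt_cost n \<F> ?\<M>"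
    unfolding opt_cost_def by (intro INF_greatest) (auto intro!: divide_le_posI_ennreal simp: mult.commute)
  then have "?V top ?init / 2 * 2 \<le> opt_cost n \<F> ?\<M> * 2" by (rule mult_right_mono) simp
  moreover have "?V top ?init / 2 * 2 = ?V top ?init"
    by (subst ennreal_divide_times, subst ennreal_divide_self) simp_all
  ultimately show ?thesis by (simp only: mult.commute)
qed

section \<open>Halving protocol for one alternative\<close>

definition ws_mean :: "ws_state \<Rightarrow> ennreal" where
  "ws_mean s = (\<integral>\<^sup>+ x. ennreal x \<partial>ws_law s)"

definition stopped :: "ws_state \<Rightarrow> bool" where
  "stopped s \<longleftrightarrow> (\<exists>D. s = Closed D)"

lemma stopped_simps [simp]: "stopped (Closed D)" "\<not> stopped (Open D)"
  by (simp_all add: stopped_def)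

text \<open>
  In the following, \<open>h\<close> is the list of states of a single alternative; length 1 means that
  it has not been weighed yet.  Lowering the floor from \<open>\<alpha> g\<close> to \<open>2 g\<close> at the first
  weighing releases an expected weight of \<open>(\<alpha> - 2) c\<close>, which covers all
  \<open>L \<le> \<alpha> - 2\<close> weighings; the unspent part is \<open>chain_debt\<close>.
\<close>

definition chain_weight :: "real \<Rightarrow> real \<Rightarrow> ws_state list \<Rightarrow> real \<Rightarrow> ennreal" where
  "chain_weight \<alpha> g h x = (if stopped (hd h) then ws_mean (hd h)
     else max (ennreal (\<alpha> * x)) (ennreal ((if length h = 1 then \<alpha> else 2) * g)))"

text \<open>The price by which the greedy policy compares alternatives: a lower bound of the weight
  for every value. It is 0 between the first weighing and stopping, where the floor no longer
  changes, so an alternative being weighed precedes all those of positive index.\<close>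

definition chain_index :: "real \<Rightarrow> real \<Rightarrow> ws_state list \<Rightarrow> ennreal" where
  "chain_index \<alpha> g h = (if stopped (hd h) then ws_mean (hd h)
     else if length h = 1 then ennreal (\<alpha> * g) else 0)"

text \<open>
  Weighing proceeds downwards from half the median until the conditional mean is dominated by
  the weight: this holds after the first outcome above a threshold (for the threshold \<open>M / 2\<close>
  because \<open>E[X | X > M / 2] \<le> 2 \<mu> \<le> \<alpha> M / 2\<close>), and as soon as \<open>X \<le> 2 g\<close> is known.
\<close>

definition halving_action :: "real \<Rightarrow> real \<Rightarrow> real \<Rightarrow> ws_state list \<Rightarrow> ws_action" where
  "halving_action \<alpha> g M h =
     (if AE x in ws_law (hd h). ws_mean (hd h) \<le> chain_weight \<alpha> g h x then Stop
      else Weigh (M / 2 ^ length h))"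

definition chain_debt :: "nat \<Rightarrow> real \<Rightarrow> ws_state list \<Rightarrow> ennreal" where
  "chain_debt L c h =
     (if stopped (hd h) \<or> length h = 1 then 0 else ennreal (c * real (L + 1 - length h)))"

text \<open>A history starts with length 1, at most \<open>L\<close> weighings follow, and stopping
  adds one more state: hence \<open>L + 1\<close> and \<open>L + 2\<close>. After a weighing, either
  the mean is dominated and the protocol will stop, or the last threshold
  \<open>M / 2 ^ (length h - 1)\<close> bounds the value.\<close>

definition chain_inv :: "real measure \<Rightarrow> real \<Rightarrow> real \<Rightarrow> real \<Rightarrow> nat \<Rightarrow> ws_state list \<Rightarrow> bool" where
  "chain_inv D M \<alpha> g L h \<longleftrightarrow> h \<noteq> [] \<and> borel_prob (ws_law (hd h)) \<and>
     (if stopped (hd h) then length h \<le> L + 2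
      else length h \<le> L + 1 \<and>
        (if length h = 1 then ws_law (hd h) = D
         else (AE x in ws_law (hd h). ws_mean (hd h) \<le> chain_weight \<alpha> g h x) \<or>
           (AE x in ws_law (hd h). x \<le> M / 2 ^ (length h - 1))))"

lemma chain_weight_measurable: "chain_weight \<alpha> g h \<in> borel_measurable borel"
  unfolding chain_weight_def by (cases "stopped (hd h)") simp_all

lemma chain_index_le_weight: "chain_index \<alpha> g h \<le> chain_weight \<alpha> g h x"
  by (simp add: chain_index_def chain_weight_def)

lemma ws_mean_le:
  assumes "borel_prob (ws_law s)" "AE x in ws_law s. x \<le> t"
  shows "ws_mean s \<le> ennreal t"
proof -
  interpret prob_space "ws_law s" using assms by (simp add: borel_prob_def)
  have "ws_mean s \<le> (\<integral>\<^sup>+ x. ennreal t \<partial>ws_law s)"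
    unfolding ws_mean_def using assms(2) by (intro nn_integral_mono_AE) (auto elim: eventually_mono intro: ennreal_leI)
  then show ?thesis by (simp add: emeasure_space_1)
qed

text \<open>\<open>L\<close> halvings bring \<open>M\<close> down to at most \<open>2 * g\<close>,
  and \<open>4 * \<mu> \<le> \<alpha> * M\<close> makes an outcome above \<open>M / 2\<close> final.
  \<open>gain\<close> says that the weight released by the first weighing pays for \<open>L\<close>
  weighings; if \<open>\<alpha> * g \<ge> \<mu>\<close>, the protocol stops at once instead.\<close>

locale weighed_alternative =
  fixes D :: "real measure" and c \<mu> M g \<alpha> :: real and L :: nat
  assumes D: "borel_prob D" and nonneg: "AE x in D. 0 \<le> x"
    and mean: "(\<integral>\<^sup>+ x. ennreal x \<partial>D) = ennreal \<mu>" and \<mu>: "0 \<le> \<mu>"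
    and M: "0 < M" "1/2 \<le> measure D {M..}"
    and g: "0 < g" and c: "0 \<le> c" and \<alpha>: "2 \<le> \<alpha>" "4 * \<mu> \<le> \<alpha> * M"
    and L: "1 \<le> L" "M \<le> 2 ^ L * (2 * g)"
    and gain: "\<alpha> * g < \<mu> \<Longrightarrow> ennreal (c * real L) \<le> ennreal (\<alpha> - 2) * (\<integral>\<^sup>+ x. ennreal (g - x) \<partial>D)"
begin

abbreviation "weight \<equiv> chain_weight \<alpha> g"
abbreviation "act \<equiv> halving_action \<alpha> g M"
abbreviation "debt \<equiv> chain_debt L c"
abbreviation "invar \<equiv> chain_inv D M \<alpha> g L"

text \<open>\<open>{M..}\<close> lies inside \<open>{M/2<..}\<close>, so the latter has mass at
  least 1/2, and conditioning on it at most doubles the mean. The open ray above \<open>M\<close>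
  could be null, hence the threshold \<open>M / 2\<close>.\<close>

lemma mean_upper_half:
  "(\<integral>\<^sup>+ x. ennreal x \<partial>uniform_measure D {M/2<..}) \<le> ennreal (2 * \<mu>)" (is "?m \<le> _")
proof -
  interpret prob_space D using D by (simp add: borel_prob_def)
  have sets: "sets D = sets borel" using D by (simp add: borel_prob_def)
  have "measure D {M..} \<le> measure D {M/2<..}"
    using M sets by (intro finite_measure_mono) auto
  then have half: "ennreal (1/2) \<le> emeasure D {M/2<..}"
    using M(2) unfolding emeasure_eq_measure by (intro ennreal_leI) linarith
  have "?m * ennreal (1/2) \<le> ?m * emeasure D {M/2<..}"
    using half by (rule mult_left_mono) simp
  also have "\<dots> = (\<integral>\<^sup>+ x. ennreal x * indicator {M/2<..} x \<partial>D)"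
    by (rule nn_integral_uniform_measure_times[OF D]) simp_all
  also have "\<dots> \<le> ennreal \<mu>"
    unfolding mean[symmetric] by (intro nn_integral_mono) (auto simp: indicator_def)
  finally have "?m * ennreal (1/2) * ennreal 2 \<le> ennreal \<mu> * ennreal 2"
    by (rule mult_right_mono) simp
  moreover have "?m * ennreal (1/2) * ennreal 2 = ?m"
    by (subst mult.assoc, subst ennreal_mult[symmetric]) simp_all
  moreover have "ennreal \<mu> * ennreal 2 = ennreal (2 * \<mu>)"
    using ennreal_mult[OF \<mu>, of 2] by (simp add: mult.commute)
  ultimately show ?thesis by simp
qed

text \<open>A weighing takes place only while the weight fails to dominate the mean. This excludes
  the first disjunct of the invariant, so the last threshold bounds the value; it excludes length
  \<open>L + 1\<close>, where that bound is below the floor \<open>2 * g\<close>; and at length 1 it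
  forces \<open>\<alpha> * g < \<mu>\<close>.\<close>

lemma weigh_imp_length:
  assumes "invar h" "\<not> stopped (hd h)" "act h = Weigh t"
  shows "length h \<le> L" "length h \<noteq> 1 \<Longrightarrow> AE x in ws_law (hd h). x \<le> 2 * t"
    "length h = 1 \<Longrightarrow> \<alpha> * g < \<mu>" "t = M / 2 ^ length h" "1 \<le> length h"
proof -
  have go: "\<not> (AE x in ws_law (hd h). ws_mean (hd h) \<le> weight h x)"
    and t: "t = M / 2 ^ length h"
    using assms(3) by (auto simp: halving_action_def split: if_splits)
  have h: "h \<noteq> []" "borel_prob (ws_law (hd h))" "length h \<le> L + 1"
    using assms(1,2) by (auto simp: chain_inv_def)
  then show pos: "1 \<le> length h" by (cases h) auto
  show "t = M / 2 ^ length h" by (rule t)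
  have mid: "AE x in ws_law (hd h). x \<le> M / 2 ^ (length h - 1)" if "length h \<noteq> 1"
    using assms(1,2) go that by (auto simp: chain_inv_def)
  have "2 * t = M / 2 ^ (length h - 1)" unfolding t using pos
    by (cases "length h") (auto simp: field_simps)
  then show "AE x in ws_law (hd h). x \<le> 2 * t" if "length h \<noteq> 1" using mid[OF that] by simp
  show "length h \<le> L"
  proof (rule ccontr)
    assume "\<not> length h \<le> L"
    then have len: "length h = L + 1" using h(3) by simp
    then have "AE x in ws_law (hd h). x \<le> M / 2 ^ L" using mid L(1) by simp
    then have "ws_mean (hd h) \<le> ennreal (M / 2 ^ L)" using h(2) by (intro ws_mean_le)
    also have "\<dots> \<le> ennreal (2 * g)" using L(2) by (intro ennreal_leI) (simp add: field_simps)
    finally have "ws_mean (hd h) \<le> weight h x" for x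
      using len L(1) assms(2) by (simp add: chain_weight_def le_max_iff_disj)
    then show False using go by simp
  qed
  show "\<alpha> * g < \<mu>" if "length h = 1"
  proof (rule ccontr)
    assume "\<not> \<alpha> * g < \<mu>"
    moreover have "ws_mean (hd h) = ennreal \<mu>"
      using assms(1,2) that mean by (simp add: chain_inv_def ws_mean_def)
    ultimately have "ws_mean (hd h) \<le> weight h x" for x
      using assms(2) that by (simp add: chain_weight_def le_max_iff_disj ennreal_leI)
    then show False using go by simp
  qed
qed

lemma inv_step:
  assumes "invar h" "\<not> stopped (hd h)" and s: "s \<in> set_pmf (ws_trans (hd h) (act h))"
  shows "invar (s # h)"
proof -
  have h: "h \<noteq> []" "borel_prob (ws_law (hd h))" "length h \<le> L + 1"
    using assms(1,2) by (auto simp: chain_inv_def)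
  have sp: "borel_prob (ws_law s)" by (rule ws_trans_borel_prob[OF h(2) s])
  show ?thesis
  proof (cases "act h")
    case Stop
    then show ?thesis using s h sp by (simp add: chain_inv_def)
  next
    case (Weigh t)
    note w = weigh_imp_length[OF assms(1,2) Weigh]
    have t: "0 < t" using w(4) M(1) by simp
    from s Weigh obtain b where b: "s = Open (uniform_measure (ws_law (hd h)) (if b then {..t} else {t<..}))"
      by auto
    have sets: "sets (ws_law (hd h)) = sets borel" using h(2) by (simp add: borel_prob_def)
    have "(AE x in ws_law s. ws_mean s \<le> weight (s # h) x) \<or> (AE x in ws_law s. x \<le> t)"
    proof (cases b)
      case True
      have "AE x in ws_law s. x \<le> t"
        unfolding b ws_law.simps using True sets by (intro AE_uniform_measureI) auto
      then show ?thesis ..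
    next
      case False
      have gt: "AE x in ws_law s. t < x"
        unfolding b ws_law.simps using False sets by (intro AE_uniform_measureI) auto
      \<comment> \<open>Above the first threshold no upper bound on the value is known and
        \<open>mean_upper_half\<close> serves; later the value lies between \<open>t\<close> and
        \<open>2 * t\<close>.\<close>
      have "ws_mean s \<le> ennreal (\<alpha> * t)"
      proof (cases "length h = 1")
        case True
        then have "ws_law (hd h) = D" "t = M / 2" using assms(1,2) w(4) by (auto simp: chain_inv_def)
        then have "ws_mean s \<le> ennreal (2 * \<mu>)"
          using mean_upper_half b False unfolding \<open>t = M / 2\<close> by (simp add: ws_mean_def)
        also have "\<dots> \<le> ennreal (\<alpha> * t)" using \<alpha>(2) unfolding \<open>t = M / 2\<close> by (intro ennreal_leI) simp
        finally show ?thesis .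
      next
        case len: False
        have "AE x in ws_law s. x \<le> 2 * t"
          unfolding b ws_law.simps using False sets w(2)[OF len]
          by (intro AE_uniform_measureI) (auto elim: eventually_mono)
        then have "ws_mean s \<le> ennreal (2 * t)" using sp by (intro ws_mean_le)
        also have "\<dots> \<le> ennreal (\<alpha> * t)" using \<alpha>(1) t by (intro ennreal_leI mult_right_mono) auto
        finally show ?thesis .
      qed
      moreover have "ennreal (\<alpha> * t) \<le> weight (s # h) x" if "t < x" for x
        using that \<alpha>(1) b by (auto simp: chain_weight_def le_max_iff_disj intro!: ennreal_leI)
      ultimately have "AE x in ws_law s. ws_mean s \<le> weight (s # h) x"
        using gt by (auto elim!: eventually_mono intro: order_trans)
      then show ?thesis ..
    qed
    moreover have "\<not> stopped s" using b by simp
    ultimately show ?thesis using sp w(1,4) h(1) unfolding chain_inv_def list.sel(1) by simp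
  qed
qed

lemma debt_step:
  assumes "invar h" "\<not> stopped (hd h)" and s: "s \<in> set_pmf (ws_trans (hd h) (act h))"
  shows "debt (s # h) \<le> (if act h = Stop then 0 else ennreal (c * real (L - length h)))"
proof (cases "act h")
  case (Weigh t)
  then show ?thesis using s weigh_imp_length[OF assms(1,2) Weigh] by (auto simp: chain_debt_def)
qed (use s in \<open>auto simp: chain_debt_def\<close>)

text \<open>For \<open>x < g\<close> the weight falls from \<open>\<alpha> * g\<close> to the larger
  of \<open>\<alpha> * x\<close> and \<open>2 * g\<close>, a drop of at least
  \<open>(\<alpha> - 2) * (g - x)\<close>. By \<open>A + \<alpha> * g \<le> B\<close>, the cap
  \<open>B\<close> hides none of this drop.\<close>

lemma gain_pointwise:
  assumes B: "A + ennreal (\<alpha> * g) \<le> B" and x: "0 \<le> x"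
  shows "ennreal (\<alpha> - 2) * ennreal (g - x) + min (A + max (ennreal (\<alpha> * x)) (ennreal (2 * g))) B
    \<le> min (A + max (ennreal (\<alpha> * x)) (ennreal (\<alpha> * g))) B"
proof (cases "x < g")
  case True
  have "\<alpha> * x \<le> \<alpha> * g" using True \<alpha>(1) by (intro mult_left_mono) auto
  then have R: "min (A + max (ennreal (\<alpha> * x)) (ennreal (\<alpha> * g))) B = A + ennreal (\<alpha> * g)"
    using B by (simp add: max_absorb2 ennreal_leI min_absorb1)
  have bound: "(\<alpha> - 2) * (g - x) + max (\<alpha> * x) (2 * g) \<le> \<alpha> * g"
  proof -
    have "0 \<le> (\<alpha> - 2) * x" using \<alpha>(1) x by simp
    then show ?thesis using True by (auto simp: max_def algebra_simps)
  qed
  have "ennreal (\<alpha> - 2) * ennreal (g - x) + min (A + max (ennreal (\<alpha> * x)) (ennreal (2 * g))) B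
      \<le> ennreal ((\<alpha> - 2) * (g - x)) + (A + ennreal (max (\<alpha> * x) (2 * g)))"
  proof (intro add_mono)
    show "ennreal (\<alpha> - 2) * ennreal (g - x) \<le> ennreal ((\<alpha> - 2) * (g - x))"
      using \<alpha>(1) True by (simp add: ennreal_mult)
    show "min (A + max (ennreal (\<alpha> * x)) (ennreal (2 * g))) B \<le> A + ennreal (max (\<alpha> * x) (2 * g))"
      by (auto simp: max_def ennreal_leI intro!: min.coboundedI1 add_left_mono)
  qed
  also have "\<dots> = A + ennreal ((\<alpha> - 2) * (g - x) + max (\<alpha> * x) (2 * g))"
    using \<alpha>(1) True g by (subst ennreal_plus) (auto simp: ac_simps)
  also have "\<dots> \<le> A + ennreal (\<alpha> * g)" using bound by (intro add_left_mono ennreal_leI)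
  finally show ?thesis unfolding R .
next
  case False
  have "2 * g \<le> \<alpha> * g" using \<alpha>(1) g by simp
  then have "min (A + max (ennreal (\<alpha> * x)) (ennreal (2 * g))) B
      \<le> min (A + max (ennreal (\<alpha> * x)) (ennreal (\<alpha> * g))) B"
    by (intro min.mono add_left_mono max.mono ennreal_leI) auto
  then show ?thesis using False by (simp add: ennreal_neg)
qed

text \<open>One-alternative estimate for the upper bound. Stopping replaces the weight by a mean
  that it dominates. Later weighings keep the weight function and are paid from the debt. Before the
  first one the debt is 0, and integrating \<open>gain_pointwise\<close> yields the cost of all
  \<open>L\<close> weighings at once.\<close>

lemma weight_step:
  assumes "invar h" "\<not> stopped (hd h)" and AB: "A + chain_index \<alpha> g h \<le> B"
  shows "ws_cost c (act h) + (if act h = Stop then 0 else ennreal (c * real (L - length h)))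
      + (\<integral>\<^sup>+ s. (\<integral>\<^sup>+ x. min (A + weight (s # h) x) B \<partial>ws_law s) \<partial>measure_pmf (ws_trans (hd h) (act h)))
    \<le> debt h + (\<integral>\<^sup>+ x. min (A + weight h x) B \<partial>ws_law (hd h))"
proof -
  have h: "h \<noteq> []" "borel_prob (ws_law (hd h))" "length h \<le> L + 1"
    using assms(1,2) by (auto simp: chain_inv_def)
  interpret prob_space "ws_law (hd h)" using h(2) by (simp add: borel_prob_def)
  show ?thesis
  proof (cases "act h")
    case Stop
    then have "AE x in ws_law (hd h). ws_mean (hd h) \<le> weight h x"
      by (auto simp: halving_action_def split: if_splits)
    then have "AE x in ws_law (hd h). min (A + ws_mean (hd h)) B \<le> min (A + weight h x) B"
      by (rule eventually_mono) (intro min.mono add_left_mono order_refl)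
    then have "(\<integral>\<^sup>+ x. min (A + ws_mean (hd h)) B \<partial>ws_law (hd h))
        \<le> (\<integral>\<^sup>+ x. min (A + weight h x) B \<partial>ws_law (hd h))"
      by (rule nn_integral_mono_AE)
    moreover have "weight (Closed (ws_law (hd h)) # h) x = ws_mean (hd h)" for x
      by (simp add: chain_weight_def ws_mean_def)
    ultimately show ?thesis
      using Stop by (auto simp: emeasure_space_1 intro: order_trans add_increasing)
  next
    case (Weigh t)
    note w = weigh_imp_length[OF assms(1,2) Weigh]
    let ?F = "\<lambda>x. min (A + max (ennreal (\<alpha> * x)) (ennreal (2 * g))) B"
    have F: "?F \<in> borel_measurable borel" by simp
    have next_weight: "weight (s # h) x = max (ennreal (\<alpha> * x)) (ennreal (2 * g))"
      if "s \<in> set_pmf (ws_trans (hd h) (act h))" for s x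
      using that Weigh h(1) by (auto simp: chain_weight_def)
    have "(\<integral>\<^sup>+ s. (\<integral>\<^sup>+ x. min (A + weight (s # h) x) B \<partial>ws_law s) \<partial>measure_pmf (ws_trans (hd h) (act h)))
        = (\<integral>\<^sup>+ s. (\<integral>\<^sup>+ x. ?F x \<partial>ws_law s) \<partial>measure_pmf (ws_trans (hd h) (act h)))"
      by (intro nn_integral_cong_AE) (auto simp: AE_measure_pmf_iff next_weight)
    also have "\<dots> = (\<integral>\<^sup>+ x. ?F x \<partial>ws_law (hd h))"
      unfolding Weigh by (rule nn_integral_weigh[OF h(2) F])
    finally have I: "(\<integral>\<^sup>+ s. (\<integral>\<^sup>+ x. min (A + weight (s # h) x) B \<partial>ws_law s) \<partial>measure_pmf (ws_trans (hd h) (act h)))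
        = (\<integral>\<^sup>+ x. ?F x \<partial>ws_law (hd h))" .
    \<comment> \<open>\<open>length h - 1\<close> weighings have been made, so
      \<open>L + 1 - length h\<close> are still covered, one of which is paid now.\<close>
    have cost: "ws_cost c (act h) + ennreal (c * real (L - length h)) = ennreal (c * real (L + 1 - length h))"
      unfolding Weigh ws_cost.simps using c w(1)
      by (subst ennreal_plus[symmetric]) (auto simp: of_nat_diff algebra_simps Suc_diff_le mult_left_mono)
    show ?thesis
    proof (cases "length h = 1")
      case False
      then have "weight h x = max (ennreal (\<alpha> * x)) (ennreal (2 * g))" for x
        using assms(2) by (simp add: chain_weight_def)
      moreover have "debt h = ennreal (c * real (L + 1 - length h))"
        using assms(2) False by (simp add: chain_debt_def)
      ultimately show ?thesis unfolding I using Weigh cost by simp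
    next
      case True
      have law: "ws_law (hd h) = D" using assms(1,2) True by (simp add: chain_inv_def)
      have sets[measurable_cong]: "sets D = sets borel" using D by (simp add: borel_prob_def)
      have W: "weight h x = max (ennreal (\<alpha> * x)) (ennreal (\<alpha> * g))" for x
        using assms(2) True by (simp add: chain_weight_def)
      have AB': "A + ennreal (\<alpha> * g) \<le> B" using AB assms(2) True by (simp add: chain_index_def)
      have "ennreal (c * real L) + (\<integral>\<^sup>+ x. ?F x \<partial>D)
          \<le> ennreal (\<alpha> - 2) * (\<integral>\<^sup>+ x. ennreal (g - x) \<partial>D) + (\<integral>\<^sup>+ x. ?F x \<partial>D)"
        using gain[OF w(3)[OF True]] by (rule add_right_mono)
      also have "\<dots> = (\<integral>\<^sup>+ x. ennreal (\<alpha> - 2) * ennreal (g - x) + ?F x \<partial>D)"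
        by (subst nn_integral_cmult[symmetric], measurable, subst nn_integral_add) measurable
      also have "\<dots> \<le> (\<integral>\<^sup>+ x. min (A + max (ennreal (\<alpha> * x)) (ennreal (\<alpha> * g))) B \<partial>D)"
        using nonneg gain_pointwise[OF AB'] by (intro nn_integral_mono_AE) (auto elim!: eventually_mono)
      finally show ?thesis
        unfolding I using Weigh cost True by (simp add: law W add_increasing)
    qed
  qed
qed

end

section \<open>Greedy policy for the committed instance\<close>

definition eligible :: "nat \<Rightarrow> nat set set \<Rightarrow> nat set \<Rightarrow> nat set" where
  "eligible n \<I> S = {i. i < n \<and> i \<notin> S \<and> insert i S \<in> \<I>}"

definition cheapest :: "nat \<Rightarrow> nat set set \<Rightarrow> (nat \<Rightarrow> 's \<Rightarrow> ennreal) \<Rightarrow> 's joint \<Rightarrow> nat" where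
  "cheapest n \<I> idx = (\<lambda>(\<sigma>, S). SOME i. i \<in> eligible n \<I> S \<and>
     (\<forall>j\<in>eligible n \<I> S. idx i (\<sigma> i) \<le> idx j (\<sigma> j)))"

definition greedy_policy ::
    "nat \<Rightarrow> nat set set \<Rightarrow> (nat \<Rightarrow> 's \<Rightarrow> ennreal) \<Rightarrow> (nat \<Rightarrow> ('s, unit) mdp) \<Rightarrow> ('s, unit) policy" where
  "greedy_policy n \<I> idx \<M> h = (let i = cheapest n \<I> idx (hd h) in
     if terminal (\<M> i) (fst (hd h) i) then Select i else Act i ())"

lemma cheapest_eligible:
  assumes "matroid {..<n} \<I>" "S \<in> \<I>" "S \<notin> basis_supersets {..<n} \<I>"
  shows "cheapest n \<I> idx (\<sigma>, S) \<in> eligible n \<I> S"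
    "\<And>j. j \<in> eligible n \<I> S \<Longrightarrow> idx (cheapest n \<I> idx (\<sigma>, S)) (\<sigma> (cheapest n \<I> idx (\<sigma>, S))) \<le> idx j (\<sigma> j)"
proof -
  have "finite (eligible n \<I> S)" unfolding eligible_def by simp
  moreover have "eligible n \<I> S \<noteq> {}"
    using matroid_eligible_exists[OF assms] unfolding eligible_def by auto
  ultimately have "\<exists>i. i \<in> eligible n \<I> S \<and> (\<forall>j\<in>eligible n \<I> S. idx i (\<sigma> i) \<le> idx j (\<sigma> j))"
    using ex_min_if_finite[of "(\<lambda>i. idx i (\<sigma> i)) ` eligible n \<I> S"] by (auto simp: not_less)
  from someI_ex[OF this]
  show "cheapest n \<I> idx (\<sigma>, S) \<in> eligible n \<I> S"
    "\<And>j. j \<in> eligible n \<I> S \<Longrightarrow> idx (cheapest n \<I> idx (\<sigma>, S)) (\<sigma> (cheapest n \<I> idx (\<sigma>, S))) \<le> idx j (\<sigma> j)"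
    unfolding cheapest_def by auto
qed

text \<open>One \<alpha> serves all alternatives, so that it can finally be pulled out of the
  completion cost.\<close>

locale weighed_matroid =
  fixes n :: nat and \<I> :: "nat set set" and D :: "nat \<Rightarrow> real measure"
    and c \<mu> M g :: "nat \<Rightarrow> real" and \<alpha> :: real and L :: "nat \<Rightarrow> nat"
  assumes mat: "matroid {..<n} \<I>"
    and alt: "\<And>i. i < n \<Longrightarrow> weighed_alternative (D i) (c i) (\<mu> i) (M i) (g i) \<alpha> (L i)"
begin

definition chain :: "nat \<Rightarrow> (ws_state list, unit) mdp" where
  "chain i = restrict_mdp (ws_mdp (D i) (c i)) (\<lambda>h. return_pmf (halving_action \<alpha> (g i) (M i) h))"

abbreviation "\<F> \<equiv> basis_supersets {..<n} \<I>"
abbreviation "wt \<equiv> \<lambda>i. chain_weight \<alpha> (g i)"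
abbreviation "idx \<equiv> \<lambda>i. chain_index \<alpha> (g i)"
abbreviation "law \<equiv> \<lambda>(i :: nat) h. ws_law (hd h)"
abbreviation "act \<equiv> \<lambda>i. halving_action \<alpha> (g i) (M i)"

lemma chain_simps:
  "start (chain i) = [Open (D i)]"
  "terminal (chain i) h \<longleftrightarrow> stopped (hd h)"
  "val (chain i) h = ws_mean (hd h)"
  "act_cost (chain i) h u = ws_cost (c i) (act i h)"
  "trans_prob (chain i) h u = map_pmf (\<lambda>s. s # h) (ws_trans (hd h) (act i h))"
  by (simp_all add: chain_def restrict_mdp_def ws_mdp_def stopped_def ws_mean_def bind_return_pmf)

definition good :: "ws_state list joint \<Rightarrow> bool" where
  "good = (\<lambda>(\<sigma>, S). S \<in> \<I> \<and> (\<forall>i<n. chain_inv (D i) (M i) \<alpha> (g i) (L i) (\<sigma> i)))"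

abbreviation "pot \<equiv> potential n \<F> top law wt"

text \<open>The debts are kept apart from the potential because weight released by a first weighing
  may be spent only after other alternatives have moved.\<close>

definition total :: "ws_state list joint \<Rightarrow> ennreal" where
  "total st = pot st + (\<Sum>j<n. chain_debt (L j) (c j) (fst st j))"

abbreviation "\<pi> \<equiv> greedy_policy n \<I> idx chain"

lemma unfinished_cases:
  assumes Q: "good (\<sigma>, S)" and unf: "S \<notin> \<F>"
  obtains (select) i where "i < n" "i \<notin> S" "insert i S \<in> \<I>" "stopped (hd (\<sigma> i))"
      "\<And>h. hd h = (\<sigma>, S) \<Longrightarrow> \<pi> h = Select i"
      "\<And>j. j \<notin> S \<Longrightarrow> insert j S \<in> \<I> \<Longrightarrow> idx i (\<sigma> i) \<le> idx j (\<sigma> j)"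
  | (advance) i where "i < n" "i \<notin> S" "insert i S \<in> \<I>" "\<not> stopped (hd (\<sigma> i))"
      "\<And>h. hd h = (\<sigma>, S) \<Longrightarrow> \<pi> h = Act i ()"
      "\<And>j. j \<notin> S \<Longrightarrow> insert j S \<in> \<I> \<Longrightarrow> idx i (\<sigma> i) \<le> idx j (\<sigma> j)"
proof -
  let ?i = "cheapest n \<I> idx (\<sigma>, S)"
  have S: "S \<in> \<I>" using Q by (simp add: good_def)
  note ch = cheapest_eligible[where idx = idx and \<sigma> = \<sigma>, OF mat S unf]
  have i: "?i < n" "?i \<notin> S" "insert ?i S \<in> \<I>" using ch(1) by (auto simp: eligible_def)
  have le: "idx ?i (\<sigma> ?i) \<le> idx j (\<sigma> j)" if "j \<notin> S" "insert j S \<in> \<I>" for j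
    using matroid_carrier[OF mat that(2)] that by (intro ch(2)) (auto simp: eligible_def)
  show ?thesis
  proof (cases "stopped (hd (\<sigma> ?i))")
    case True
    then show ?thesis using i le by (intro select[of ?i]) (auto simp: greedy_policy_def chain_simps Let_def)
  next
    case False
    then show ?thesis using i le by (intro advance[of ?i]) (auto simp: greedy_policy_def chain_simps Let_def)
  qed
qed

text \<open>Advancing lengthens one history and selecting enlarges \<open>S\<close>; the sum of
  these sizes is the counter for termination.\<close>

lemma good_step:
  assumes Q: "good (hd h)" and unf: "\<not> finished \<F> h"
    and s: "s \<in> set_pmf (move_result chain (hd h) (\<pi> h))"
  shows "good s \<and> (\<Sum>i<n. length (fst (hd h) i)) + card (snd (hd h))
    < (\<Sum>i<n. length (fst s i)) + card (snd s)"
proof -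
  obtain \<sigma> S where st: "hd h = (\<sigma>, S)" by force
  have Q': "good (\<sigma>, S)" and unf': "S \<notin> \<F>" using Q unf st by (simp_all add: finished_def)
  then have S: "S \<in> \<I>" by (simp add: good_def)
  from Q' unf' show ?thesis
  proof (cases rule: unfinished_cases)
    case (select i)
    then have "s = (\<sigma>, insert i S)" using s st by simp
    then show ?thesis using Q' select matroid_finite[OF mat S] st by (simp add: good_def)
  next
    case (advance i)
    then obtain t where t: "t \<in> set_pmf (ws_trans (hd (\<sigma> i)) (act i (\<sigma> i)))" "s = (\<sigma>(i := t # \<sigma> i), S)"
      using s st by (auto simp: chain_simps)
    have "chain_inv (D i) (M i) \<alpha> (g i) (L i) (t # \<sigma> i)"
      using weighed_alternative.inv_step[OF alt[OF advance(1)] _ advance(4) t(1)] Q' advance(1)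
      by (simp add: good_def)
    then have "good s" using Q' t(2) by (simp add: good_def)
    moreover have "(\<Sum>j<n. length (\<sigma> j)) < (\<Sum>j<n. length ((\<sigma>(i := t # \<sigma> i)) j))"
      using advance(1) by (intro sum_strict_mono_ex1) auto
    ultimately show ?thesis using st t(2) by simp
  qed
qed

lemma good_start: "good (\<lambda>i. start (chain i), {})"
  using weighed_alternative.D[OF alt] mat by (auto simp: good_def chain_simps chain_inv_def matroid_def)

lemma finishes: "finishes_almost_surely \<F> chain \<pi>"
proof (rule finishes_almost_surelyI_counter[where Q = good
      and r = "\<lambda>st. (\<Sum>i<n. length (fst st i)) + card (snd st)" and N = "(\<Sum>i<n. L i + 2) + n"])
  fix st assume "good st"
  moreover obtain \<sigma> S where st: "st = (\<sigma>, S)" by force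
  ultimately have S: "S \<in> \<I>" and inv: "\<And>i. i < n \<Longrightarrow> chain_inv (D i) (M i) \<alpha> (g i) (L i) (\<sigma> i)"
    by (auto simp: good_def)
  have "card S \<le> n"
    using card_mono[OF _ matroid_carrier[OF mat S]] by simp
  moreover have "length (\<sigma> i) \<le> L i + 2" if "i < n" for i
    using inv[OF that] by (auto simp: chain_inv_def split: if_splits)
  ultimately show "(\<Sum>i<n. length (fst st i)) + card (snd st) \<le> (\<Sum>i<n. L i + 2) + n"
    unfolding st fst_conv snd_conv by (intro add_mono sum_mono) auto
qed (use good_start good_step in auto)

lemma total_step:
  assumes Q: "good (hd h)" and unf: "\<not> finished \<F> h"
  shows "move_cost chain (hd h) (\<pi> h) + (\<integral>\<^sup>+ s. total s \<partial>measure_pmf (move_result chain (hd h) (\<pi> h)))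
    \<le> total (hd h)"
proof -
  obtain \<sigma> S where st: "hd h = (\<sigma>, S)" by force
  have Q': "good (\<sigma>, S)" and unf': "S \<notin> \<F>" using Q unf st by (simp_all add: finished_def)
  have inv: "chain_inv (D j) (M j) \<alpha> (g j) (L j) (\<sigma> j)" if "j < n" for j
    using Q' that by (simp add: good_def)
  then have \<sigma>: "borel_prob (ws_law (hd (\<sigma> j)))" if "j < n" for j
    using that by (simp add: chain_inv_def)
  let ?debt = "\<lambda>j. chain_debt (L j) (c j)"
  from Q' unf' show ?thesis
  proof (cases rule: unfinished_cases)
    case (select i)
    have "ws_mean (hd (\<sigma> i)) + pot (\<sigma>, insert i S) \<le> pot (\<sigma>, S)"
    proof (rule potential_select_upper[where law = law and \<sigma> = \<sigma> and wt = wt,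
          OF mat chain_weight_measurable \<sigma> select(2,3)])
      show "wt i (\<sigma> i) y = ws_mean (hd (\<sigma> i))" for y
        using select(4) by (simp add: chain_weight_def)
      \<comment> \<open>Index and weight of a stopped alternative agree, so the least index bounds
        the weights of all rivals from below.\<close>
      show "ws_mean (hd (\<sigma> i)) \<le> wt j (\<sigma> j) y" if "j \<notin> S" "insert j S \<in> \<I>" for j y
        using select(6)[OF that] select(4) chain_index_le_weight[of \<alpha> "g j" "\<sigma> j" y]
        by (simp add: chain_index_def[of \<alpha> "g i"])
    qed
    then have "ws_mean (hd (\<sigma> i)) + total (\<sigma>, insert i S) \<le> total (\<sigma>, S)"
      unfolding total_def add.assoc[symmetric] by (simp add: add_right_mono)
    then show ?thesis using select(5)[OF st] st by (simp add: chain_simps)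
  next
    case (advance i)
    let ?p = "ws_trans (hd (\<sigma> i)) (act i (\<sigma> i))"
    \<comment> \<open>\<open>?\<rho>\<close> bounds the debt of \<open>i\<close> after the move; the
      other debts, collected in \<open>?rest\<close>, do not change.\<close>
    let ?\<rho> = "if act i (\<sigma> i) = Stop then 0 else ennreal (c i * real (L i - length (\<sigma> i)))"
    let ?rest = "\<Sum>j\<in>{..<n} - {i}. ?debt j (\<sigma> j)"
    note w = alt[OF advance(1)]
    have P: "finite (set_pmf (map_pmf (\<lambda>s. s # \<sigma> i) ?p))" by (simp add: finite_set_pmf_ws_trans)
    have main: "ws_cost (c i) (act i (\<sigma> i)) + ?\<rho>
        + (\<integral>\<^sup>+ h'. pot (\<sigma>(i := h'), S) \<partial>measure_pmf (map_pmf (\<lambda>s. s # \<sigma> i) ?p))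
        \<le> ?debt i (\<sigma> i) + pot (\<sigma>, S)"
    proof (rule potential_step_upper[where law = law and \<sigma> = \<sigma> and wt = wt and \<theta> = "idx i (\<sigma> i)",
          OF mat chain_weight_measurable \<sigma> advance(1-3) P])
      show "borel_prob (ws_law (hd s))" if "s \<in> set_pmf (map_pmf (\<lambda>s. s # \<sigma> i) ?p)" for s
        using that ws_trans_borel_prob[OF \<sigma>[OF advance(1)]] by auto
      show "idx i (\<sigma> i) \<le> wt j (\<sigma> j) y" if "j \<notin> S" "insert j S \<in> \<I>" for j y
        using advance(6)[OF that] chain_index_le_weight by (rule order_trans)
      show "ws_cost (c i) (act i (\<sigma> i)) + ?\<rho> + (\<integral>\<^sup>+ s. (\<integral>\<^sup>+ y. min (A + wt i s y) B \<partial>ws_law (hd s))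
            \<partial>measure_pmf (map_pmf (\<lambda>s. s # \<sigma> i) ?p))
          \<le> ?debt i (\<sigma> i) + (\<integral>\<^sup>+ y. min (A + wt i (\<sigma> i) y) B \<partial>ws_law (hd (\<sigma> i)))"
        if "A + idx i (\<sigma> i) \<le> B" for A B
        using weighed_alternative.weight_step[OF w inv[OF advance(1)] advance(4) that] by simp
    qed
    have "(\<integral>\<^sup>+ s. total (\<sigma>(i := s # \<sigma> i), S) \<partial>measure_pmf ?p)
        \<le> (\<integral>\<^sup>+ s. pot (\<sigma>(i := s # \<sigma> i), S) + (?\<rho> + ?rest) \<partial>measure_pmf ?p)"
    proof (intro nn_integral_mono_AE, unfold AE_measure_pmf_iff, intro ballI)
      fix s assume "s \<in> set_pmf ?p"
      then have "?debt i (s # \<sigma> i) \<le> ?\<rho>"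
        by (rule weighed_alternative.debt_step[OF w inv[OF advance(1)] advance(4)])
      moreover have "(\<Sum>j<n. ?debt j ((\<sigma>(i := s # \<sigma> i)) j)) = ?debt i (s # \<sigma> i) + ?rest"
        using advance(1) by (subst sum.remove[of _ i]) auto
      ultimately show "total (\<sigma>(i := s # \<sigma> i), S) \<le> pot (\<sigma>(i := s # \<sigma> i), S) + (?\<rho> + ?rest)"
        unfolding total_def fst_conv by (simp only: add_left_mono add_right_mono)
    qed
    also have "\<dots> = (\<integral>\<^sup>+ s. pot (\<sigma>(i := s # \<sigma> i), S) \<partial>measure_pmf ?p) + (?\<rho> + ?rest)"
      by (subst nn_integral_add) auto
    finally have "ws_cost (c i) (act i (\<sigma> i)) + (\<integral>\<^sup>+ s. total (\<sigma>(i := s # \<sigma> i), S) \<partial>measure_pmf ?p)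
        \<le> ws_cost (c i) (act i (\<sigma> i)) + ((\<integral>\<^sup>+ s. pot (\<sigma>(i := s # \<sigma> i), S) \<partial>measure_pmf ?p) + (?\<rho> + ?rest))"
      by (rule add_left_mono)
    also have "\<dots> = ws_cost (c i) (act i (\<sigma> i)) + ?\<rho>
        + (\<integral>\<^sup>+ h'. pot (\<sigma>(i := h'), S) \<partial>measure_pmf (map_pmf (\<lambda>s. s # \<sigma> i) ?p)) + ?rest"
      by (simp add: ac_simps)
    also have "\<dots> \<le> ?debt i (\<sigma> i) + pot (\<sigma>, S) + ?rest" by (rule add_right_mono[OF main])
    also have "\<dots> = total (\<sigma>, S)"
      unfolding total_def using advance(1) by (subst sum.remove[of _ i]) (auto simp: ac_simps)
    finally show ?thesis using advance(5)[OF st] st by (simp add: chain_simps)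
  qed
qed

lemma chain_opt_cost_le: "opt_cost n \<F> chain \<le> pot (\<lambda>i. [Open (D i)], {})"
proof -
  have "opt_cost n \<F> chain \<le> expected_cost n \<F> chain \<pi>"
    unfolding opt_cost_def using finishes by (intro INF_lower) simp
  also have "\<dots> \<le> total (\<lambda>i. start (chain i), {})"
  proof (rule expected_cost_le_potential[where Q = good])
    fix h :: "ws_state list joint list"
    assume Q: "good (hd h)" and unf: "\<not> finished \<F> h"
    obtain \<sigma> S where st: "hd h = (\<sigma>, S)" by force
    with Q unf have "good (\<sigma>, S)" "S \<notin> \<F>" by (simp_all add: finished_def)
    then show "legal n chain (hd h) (\<pi> h)"
      by (cases rule: unfinished_cases) (simp_all add: st chain_simps)
  qed (use good_start good_step total_step in auto)
  also have "\<dots> = pot (\<lambda>i. [Open (D i)], {})"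
    by (simp add: total_def chain_simps chain_debt_def)
  finally show ?thesis .
qed

end

section \<open>Commitment gap\<close>

text \<open>\<open>y = 0\<close> forces \<open>x = 0\<close>, and then the quotient is 0.\<close>

lemma ennreal_divide_leI:
  fixes x y a :: ennreal
  assumes "x \<le> a * y"
  shows "x / y \<le> a"
  using assms divide_le_posI_ennreal[of y x a] by (cases "y = 0") (auto simp: zero_less_iff_neq_zero mult.commute)

text \<open>At the start the floor is \<open>\<alpha> * g\<close>, so the weights of the committed
  chain are \<alpha> times those of the lower bound. Both estimates concern the same expectation,
  and the factors \<alpha> and 2 multiply.\<close>

lemma ws_commitment_gap_le:
  assumes wm: "weighed_matroid n \<I> D c \<mu> M g \<alpha> L" and \<alpha>: "0 < \<alpha>"
    and g: "\<And>i. i < n \<Longrightarrow> ennreal (g i) \<le> (\<integral>\<^sup>+ x. ennreal x \<partial>D i)"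
    and c: "\<And>i. i < n \<Longrightarrow> (\<integral>\<^sup>+ x. ennreal (g i - x) \<partial>D i) \<le> ennreal (c i)"
  shows "ws_commitment_gap n \<I> D c \<le> ennreal (2 * \<alpha>)"
proof -
  interpret weighed_matroid n \<I> D c \<mu> M g \<alpha> L by (rule wm)
  let ?wt = "\<lambda>i. ws_weight (D i) (g i)"
  let ?OPT = "opt_cost n \<F> (\<lambda>i. ws_mdp (D i) (c i))"
  let ?P = "PiM {..<n} (law_family n (\<lambda>_. ws_law) (\<lambda>i. Open (D i)))"
  have sub: "\<F> \<subseteq> Pow {..<n}" by (auto simp: basis_supersets_def)
  have D: "borel_prob (D i)" if "i < n" for i using weighed_alternative.D[OF alt[OF that]] .
  have "(INF \<phi>. opt_cost n \<F> (\<lambda>i. restrict_mdp (ws_mdp (D i) (c i)) (\<phi> i))) \<le> opt_cost n \<F> chain"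
    unfolding chain_def by (intro INF_lower) simp
  also have "\<dots> \<le> potential n \<F> top law wt (\<lambda>i. [Open (D i)], {})" by (rule chain_opt_cost_le)
  also have "\<dots> = (\<integral>\<^sup>+ x. ennreal \<alpha> * completion_cost \<F> {} (\<lambda>j. ?wt j (Open (D j)) (x j)) \<partial>?P)"
  proof -
    have law: "law_family n law (\<lambda>i. [Open (D i)]) = law_family n (\<lambda>_. ws_law) (\<lambda>i. Open (D i))"
      by (simp add: law_family_def fun_eq_iff)
    have weight: "wt j [Open (D j)] x = ennreal \<alpha> * ?wt j (Open (D j)) x" for j x
    proof -
      have "max (ennreal \<alpha> * ennreal x) (ennreal \<alpha> * ennreal (g j)) = ennreal \<alpha> * max (ennreal x) (ennreal (g j))"
        by (rule max_of_mono) (auto intro!: monoI mult_left_mono)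
      then show ?thesis using \<alpha> by (simp add: chain_weight_def ennreal_mult')
    qed
    show ?thesis
      unfolding potential_def prod.case law weight
      using \<alpha> by (simp only: completion_cost_cmult[OF finite_feasible(1)[OF sub ws_weight_measurable]]) simp
  qed
  also have "\<dots> = ennreal \<alpha> * potential n \<F> top (\<lambda>_. ws_law) ?wt (\<lambda>i. Open (D i), {})"
    using integrand_measurable[where b = top and S = "{}" and law = "\<lambda>_. ws_law"
        and \<sigma> = "\<lambda>i. Open (D i)" and wt = ?wt, OF sub ws_weight_measurable] D
    by (subst nn_integral_cmult) (simp_all add: potential_def)
  also have "\<dots> \<le> ennreal \<alpha> * (2 * ?OPT)"
    by (intro mult_left_mono ws_opt_cost_lower_bound[OF sub D g c]) auto
  also have "\<dots> = ennreal (2 * \<alpha>) * ?OPT"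
    using \<alpha> by (simp add: ennreal_mult mult.assoc mult.left_commute)
  finally show ?thesis
    unfolding ws_commitment_gap_def commitment_gap_def by (rule ennreal_divide_leI)
qed

section \<open>Number of halvings, and choice of the constants\<close>

lemma halving_steps_exist:
  assumes "0 < g" "0 < M" "M \<le> 2 * \<mu>" "g \<le> \<mu>"
  shows "\<exists>L::nat. 1 \<le> L \<and> M \<le> 2 ^ L * (2 * g) \<and> real L \<le> 2 + 2 * ln (\<mu> / g)"
proof -
  \<comment> \<open>The ceiling gives \<open>2 ^ L * g \<ge> 2 * \<mu> \<ge> M\<close>, and the
    summand 1 makes \<open>L\<close> positive.\<close>
  define L where "L = nat \<lceil>log 2 (\<mu> / g)\<rceil> + 1"
  have pos: "1 \<le> \<mu> / g" using assms by simp
  have "log 2 (\<mu> / g) \<le> real (nat \<lceil>log 2 (\<mu> / g)\<rceil>)" by (rule real_nat_ceiling_ge)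
  then have "\<mu> / g \<le> 2 powr real (nat \<lceil>log 2 (\<mu> / g)\<rceil>)"
    using pos by (subst (asm) log_le_iff) auto
  then have "\<mu> \<le> 2 ^ nat \<lceil>log 2 (\<mu> / g)\<rceil> * g"
    using assms(1) by (simp add: powr_realpow field_simps)
  then have "M \<le> 2 ^ L * (2 * g)"
    using assms unfolding L_def power_add by simp
  moreover have "real L \<le> 2 + 2 * ln (\<mu> / g)"
  proof -
    have "0 \<le> log 2 (\<mu> / g)" using pos by simp
    then have "real L \<le> 2 + log 2 (\<mu> / g)" unfolding L_def by linarith
    \<comment> \<open>\<open>2 * ln 2 \<ge> 1\<close> converts the binary logarithm.\<close>
    also have "log 2 (\<mu> / g) \<le> 2 * ln (\<mu> / g)"
      using pos ln2_ge_two_thirds mult_left_mono[of 1 "2 * ln 2" "ln (\<mu> / g)"]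
      by (simp add: log_def divide_le_eq mult_ac)
    finally show ?thesis by simp
  qed
  ultimately show ?thesis by (intro exI[of _ L]) (simp add: L_def)
qed

text \<open>Markov's inequality at \<open>M\<close>.\<close>

lemma median_le_twice_mean:
  assumes D: "borel_prob D" and mean: "(\<integral>\<^sup>+ x. ennreal x \<partial>D) = ennreal \<mu>" "0 \<le> \<mu>"
    and M: "0 < M" "1/2 \<le> measure D {M..}"
  shows "M \<le> 2 * \<mu>"
proof -
  interpret prob_space D using D by (simp add: borel_prob_def)
  have "ennreal (M * (1/2)) \<le> ennreal (M * measure D {M..})"
    using M by (intro ennreal_leI mult_left_mono) auto
  also have "\<dots> = (\<integral>\<^sup>+ x. ennreal M * indicator {M..} x \<partial>D)"
    using M(1) D by (subst nn_integral_cmult_indicator) (auto simp: borel_prob_def emeasure_eq_measure ennreal_mult)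
  also have "\<dots> \<le> (\<integral>\<^sup>+ x. ennreal x \<partial>D)"
    by (intro nn_integral_mono) (auto simp: indicator_def intro: ennreal_leI)
  finally show ?thesis using mean M(1) by simp
qed

theorem theorem7:
  shows "\<exists>C::real. C > 0 \<and>
    (\<forall>(n::nat) (\<I>::nat set set) (D::nat \<Rightarrow> real measure) (c::nat \<Rightarrow> real)
       (M::nat \<Rightarrow> real) (g::nat \<Rightarrow> real).
      matroid_ws_instance n \<I> D c \<longrightarrow>
      (\<forall>i<n. is_median (D i) (M i)) \<longrightarrow>
      (\<forall>i<n. solves_gittins_equation (D i) (c i) (g i)) \<longrightarrow>
      ws_commitment_gap n \<I> D c \<le> ennreal C * (SUP i\<in>{..<n}. ws_kappa (D i) (M i) (g i)))"
proof (intro exI[of _ 20] conjI allI impI)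
  fix n :: nat and \<I> :: "nat set set" and D :: "nat \<Rightarrow> real measure" and c M g :: "nat \<Rightarrow> real"
  assume inst: "matroid_ws_instance n \<I> D c" and med: "\<forall>i<n. is_median (D i) (M i)"
    and git: "\<forall>i<n. solves_gittins_equation (D i) (c i) (g i)"
  let ?S = "SUP i\<in>{..<n}. ws_kappa (D i) (M i) (g i)"
  have mat: "matroid {..<n} \<I>" using inst by (simp add: matroid_ws_instance_def)
  consider (zero) "n = 0" | (inf) "?S = top" | (fin) K where "0 < n" "?S = ennreal K" "0 \<le> K"
    by (metis ennreal_cases gr0I top_neq_ennreal)
  then show "ws_commitment_gap n \<I> D c \<le> ennreal 20 * ?S"
  proof cases
    \<comment> \<open>The supremum over no alternatives is 0, so the gap itself must vanish: the
      empty set is feasible and nothing is paid.\<close>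
    case zero
    then interpret weighed_matroid n \<I> D c "\<lambda>_. 0" M g 2 "\<lambda>_. 0"
      using mat by unfold_locales auto
    have "{} \<in> \<F>" using mat zero by (auto simp: basis_supersets_def matroid_basis_def matroid_def)
    then have "opt_cost n \<F> chain = 0"
      using chain_opt_cost_le by (simp add: potential_def completion_cost_feasible)
    moreover have "(INF \<phi>. opt_cost n \<F> (\<lambda>i. restrict_mdp (ws_mdp (D i) (c i)) (\<phi> i))) \<le> opt_cost n \<F> chain"
      unfolding chain_def by (intro INF_lower) simp
    ultimately show ?thesis by (simp add: ws_commitment_gap_def commitment_gap_def)
  next
    case inf
    show ?thesis unfolding inf by (simp add: ennreal_mult_top)
  next
    case fin
    \<comment> \<open>The factor 10, with the 2 of \<open>ws_commitment_gap_le\<close>, gives the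
      constant 20.\<close>
    define \<alpha> where "\<alpha> = 10 * K"
    define \<mu> where "\<mu> i = mean (D i)" for i
    \<comment> \<open>With the cap the Gittins equation becomes an inequality, which suffices for
      the lower bound on the optimum.\<close>
    define g' where "g' i = min (g i) (\<mu> i)" for i
    have ex: "\<exists>L. weighed_alternative (D i) (c i) (\<mu> i) (M i) (g' i) \<alpha> L \<and> 0 < \<alpha> \<and>
        ennreal (g' i) \<le> (\<integral>\<^sup>+ x. ennreal x \<partial>D i) \<and>
        (\<integral>\<^sup>+ x. ennreal (g' i - x) \<partial>D i) \<le> ennreal (c i)" if i: "i < n" for i
    proof -
      have D: "borel_prob (D i)" and nonneg: "AE x in D i. 0 \<le> x"
        and int: "integrable (D i) (\<lambda>x. x)" and c: "0 \<le> c i"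
        using inst i by (auto simp: matroid_ws_instance_def borel_prob_def)
      interpret prob_space "D i" using D by (simp add: borel_prob_def)
      have \<mu>0: "0 \<le> \<mu> i" unfolding \<mu>_def mean_def using nonneg by (rule integral_nonneg_AE)
      have mean: "(\<integral>\<^sup>+ x. ennreal x \<partial>D i) = ennreal (\<mu> i)"
        unfolding \<mu>_def mean_def using int nonneg by (rule nn_integral_eq_integral)
      have "ws_kappa (D i) (M i) (g i) \<le> ennreal K"
        unfolding fin(2)[symmetric] using i by (intro SUP_upper) simp
      then have M: "0 < M i" and gpos: "0 < g i"
        and kappa: "\<mu> i / M i + ln (\<mu> i / g' i) \<le> K"
        using fin(3) by (auto simp: ws_kappa_def \<mu>_def g'_def top_unique split: if_splits)
      have half: "1/2 \<le> measure (D i) {M i..}" using med i by (simp add: is_median_def)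
      have M2: "M i \<le> 2 * \<mu> i" by (rule median_le_twice_mean[OF D mean \<mu>0 M half])
      then have \<mu>: "0 < \<mu> i" using M by simp
      then have g': "0 < g' i" "g' i \<le> \<mu> i" "g' i \<le> g i" using gpos by (auto simp: g'_def)
      \<comment> \<open>Since the ratio is at least 1/2, \<open>10 * K\<close> is at least 5 plus
        ten times the logarithm, which leaves room for all three bounds on \<alpha>.\<close>
      have "1/2 \<le> \<mu> i / M i" using M M2 by (simp add: field_simps)
      moreover have "0 \<le> ln (\<mu> i / g' i)" using g' by simp
      ultimately have \<alpha>: "4 + 2 * ln (\<mu> i / g' i) \<le> \<alpha>" "4 \<le> \<alpha>" "4 * (\<mu> i / M i) \<le> \<alpha>"
        using kappa unfolding \<alpha>_def by linarith+
      have gittins: "(\<integral>\<^sup>+ x. ennreal (g i - x) \<partial>D i) = ennreal (c i)"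
      proof -
        have "(\<integral>\<^sup>+ x. ennreal (g i - x) \<partial>D i) = (\<integral>\<^sup>+ x. ennreal (max (g i - x) 0) \<partial>D i)"
          by (intro nn_integral_cong) (simp add: max_def ennreal_neg)
        also have "\<dots> = ennreal (\<integral>x. max (g i - x) 0 \<partial>D i)"
          using int by (intro nn_integral_eq_integral) auto
        finally show ?thesis using git i by (simp add: solves_gittins_equation_def)
      qed
      have cost: "(\<integral>\<^sup>+ x. ennreal (g' i - x) \<partial>D i) \<le> ennreal (c i)"
        unfolding gittins[symmetric] using g'(3) by (intro nn_integral_mono ennreal_leI) simp
      obtain L where L: "1 \<le> L" "M i \<le> 2 ^ L * (2 * g' i)" "real L \<le> 2 + 2 * ln (\<mu> i / g' i)"
        using halving_steps_exist[OF g'(1) M M2 g'(2)] by blast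
      have gain: "ennreal (c i * real L) \<le> ennreal (\<alpha> - 2) * (\<integral>\<^sup>+ x. ennreal (g' i - x) \<partial>D i)"
        if less: "\<alpha> * g' i < \<mu> i"
      proof -
        \<comment> \<open>As \<alpha> is at least 1, a mean above \<open>\<alpha> * g' i\<close>
          shows that the cap is inactive, so the exact Gittins equation is available. It turns the
          released weight into \<open>(\<alpha> - 2) * c i\<close>, and
          \<open>L \<le> \<alpha> - 2\<close>.\<close>
        have "1 * \<mu> i \<le> \<alpha> * \<mu> i" using \<alpha>(2) \<mu>0 by (intro mult_right_mono) auto
        then have "g' i = g i" using less by (auto simp: g'_def min_def split: if_splits)
        moreover have "c i * real L \<le> (\<alpha> - 2) * c i"
          using c L(3) \<alpha>(1) by (subst mult.commute) (intro mult_right_mono, auto)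
        ultimately show ?thesis
          using gittins \<alpha>(2) c by (simp add: ennreal_mult[symmetric] ennreal_leI)
      qed
      have "4 * \<mu> i \<le> \<alpha> * M i" using \<alpha>(3) M by (simp add: field_simps)
      then have "weighed_alternative (D i) (c i) (\<mu> i) (M i) (g' i) \<alpha> L"
        using D nonneg mean \<mu>0 M half g'(1) c \<alpha>(2) L gain by unfold_locales auto
      then show ?thesis using \<alpha>(2) cost g'(2) mean by (auto intro: ennreal_leI)
    qed
    then obtain L where "\<And>i. i < n \<Longrightarrow> weighed_alternative (D i) (c i) (\<mu> i) (M i) (g' i) \<alpha> (L i)"
      by metis
    then have wm: "weighed_matroid n \<I> D c \<mu> M g' \<alpha> L" using mat by (intro weighed_matroid.intro)
    have "ws_commitment_gap n \<I> D c \<le> ennreal (2 * \<alpha>)"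
      using ex fin(1) by (intro ws_commitment_gap_le[OF wm]) auto
    also have "\<dots> = ennreal 20 * ?S"
      unfolding fin(2) \<alpha>_def using ennreal_mult[of 20 K] fin(3) by simp
    finally show ?thesis .
  qed
qed simp

end
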